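(* The quaternary quadratic form $Q_{47}^1=x^2+2y^2+4z^2+7w^2+2zw+2yz$ (Gram matrix $\begin{pmatrix}1&0&0&0\\0&2&1&0\\0&1&4&1\\0&0&1&7\end{pmatrix}$) is primitively universal.
   Context: A quadratic form $f$ in variables $x,y,z,w$ is primitively universal if for every positive integer $n$ the equation $f(x,y,z,w)=n$ has an integer solution with $\gcd(x,y,z,w)=1$. *)

theory Defs
  imports Main
begin

definition primitively_universal :: "(int \<Rightarrow> int \<Rightarrow> int \<Rightarrow> int \<Rightarrow> int) \<Rightarrow> bool" where
  "primitively_universal f \<longleftrightarrow>
     (\<forall>n>0. \<exists>x y z w. f x y z w = n \<and> Gcd {x, y, z, w} = 1)"

definition Q47_1 :: "int \<Rightarrow> int \<Rightarrow> int \<Rightarrow> int \<Rightarrow> int" where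
  "Q47_1 x y z w = x\<^sup>2 + 2 * y\<^sup>2 + 4 * z\<^sup>2 + 7 * w\<^sup>2 + 2 * z * w + 2 * y * z"

definition gram_Q47_1 :: "int list list" where
  "gram_Q47_1 =
     [[1, 0, 0, 0],
      [0, 2, 1, 0],
      [0, 1, 4, 1],
      [0, 0, 1, 7]]"

lemma Q47_1_eq_gram:
  "Q47_1 x y z w =
     (\<Sum>i<4. \<Sum>j<4. [x, y, z, w] ! i * gram_Q47_1 ! i ! j * [x, y, z, w] ! j)"
  by (simp add: Q47_1_def gram_Q47_1_def eval_nat_numeral algebra_simps power2_eq_square)

end

theory Submission
  imports Defs "HOL-Analysis.Analysis" "HOL-Number_Theory.Number_Theory" "HOL-Computational_Algebra.Squarefree"
begin

text \<open>
  Write \<open>N(p, q) = p\<^sup>2 + p q + 2 q\<^sup>2\<close>. Completing the square with respect to \<open>w\<close> shows that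
  \<open>n\<close> is represented with last coordinate \<open>w\<close> prime to 7 as soon as
  \<open>M = 7 n - 47 w\<^sup>2\<close> has the form \<open>7 x\<^sup>2 + 2 N(p, q)\<close>. This ternary form shares its genus
  with exactly one other class, \<open>7 x\<^sup>2 + 7 y\<^sup>2 + z\<^sup>2\<close>, which is a 3-neighbour of it, and every value
  of the second form not congruent to 1 modulo 3 is also a value of the first. So for large \<open>n\<close> the choice
  \<open>w = 1\<close>, which makes the vector primitive, works unless 3 divides \<open>n\<close>; then \<open>w = 3\<close> or
  \<open>w = 9\<close> works.

  A positive \<open>M\<close> that is a nonzero square modulo 7 is represented by the genus: a ternary Gram matrix of
  determinant 7 with diagonal entry \<open>7 M\<close> exists if there is \<open>a > 0\<close> with \<open>- 7 a\<close> a square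
  modulo \<open>M\<close> and \<open>- M\<close> a square modulo \<open>a\<close>. Instead of taking \<open>a\<close> prime by Dirichlet's
  theorem, consider the numbers \<open>A\<close> in the class of \<open>- 7\<close> modulo \<open>8 M\<close> with
  \<open>r(A) = (\<Sum>d | d dvd A. \<chi>(d)) > 0\<close>, where \<open>\<chi>\<close> is the quadratic character of
  discriminant \<open>- M\<close>; the squarefree part of such an \<open>A\<close> will do. As \<open>\<chi>(- 7) = 1\<close>, the
  function \<open>\<chi>(d) ([d e = - 7] - [d e = 1])\<close> of two residues has zero row and column sums, so the
  power series of \<open>r\<close> over the classes of \<open>- 7\<close> and of \<open>1\<close> differ by a bounded amount
  as \<open>t \<rightarrow> 1\<close>. The squares make the second one unbounded, hence also the first.
\<close>

section \<open>Lambert series with balanced coefficients\<close>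

text \<open>A single constant serves as bound and as Lipschitz constant. Both conditions together
  pass to sums, to products and to inverses of functions that are at least 1.\<close>

definition bounded_lipschitz :: "(real \<Rightarrow> real) \<Rightarrow> bool" where
  "bounded_lipschitz f \<longleftrightarrow> (\<exists>C. \<forall>u\<in>{0..1}. \<forall>v\<in>{0..1}. \<bar>f u\<bar> \<le> C \<and> \<bar>f u - f v\<bar> \<le> C * \<bar>u - v\<bar>)"

lemma bounded_lipschitzI:
  assumes "\<And>u. 0 \<le> u \<Longrightarrow> u \<le> 1 \<Longrightarrow> \<bar>f u\<bar> \<le> B"
    and "\<And>u v. 0 \<le> u \<Longrightarrow> u \<le> 1 \<Longrightarrow> 0 \<le> v \<Longrightarrow> v \<le> 1 \<Longrightarrow> \<bar>f u - f v\<bar> \<le> C * \<bar>u - v\<bar>"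
  shows "bounded_lipschitz f"
  unfolding bounded_lipschitz_def
proof (intro exI[of _ "max B C"] ballI conjI)
  fix u v :: real assume uv: "u \<in> {0..1}" "v \<in> {0..1}"
  show "\<bar>f u\<bar> \<le> max B C" using assms(1)[of u] uv by auto
  have "\<bar>f u - f v\<bar> \<le> C * \<bar>u - v\<bar>" using assms(2)[of u v] uv by auto
  also have "\<dots> \<le> max B C * \<bar>u - v\<bar>" by (intro mult_right_mono) auto
  finally show "\<bar>f u - f v\<bar> \<le> max B C * \<bar>u - v\<bar>" .
qed

lemma bounded_lipschitzE:
  assumes "bounded_lipschitz f"
  obtains C where "C \<ge> 0" "\<And>u. 0 \<le> u \<Longrightarrow> u \<le> 1 \<Longrightarrow> \<bar>f u\<bar> \<le> C"
    "\<And>u v. 0 \<le> u \<Longrightarrow> u \<le> 1 \<Longrightarrow> 0 \<le> v \<Longrightarrow> v \<le> 1 \<Longrightarrow> \<bar>f u - f v\<bar> \<le> C * \<bar>u - v\<bar>"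
proof -
  obtain C where C: "\<forall>u\<in>{0..1}. \<forall>v\<in>{0..1}. \<bar>f u\<bar> \<le> C \<and> \<bar>f u - f v\<bar> \<le> C * \<bar>u - v\<bar>"
    using assms unfolding bounded_lipschitz_def by blast
  then have "\<bar>f 0\<bar> \<le> C" using atLeastAtMost_iff zero_le_one by blast
  then have "C \<ge> 0" by linarith
  with C that show thesis by auto
qed

lemma bounded_lipschitz_const: "bounded_lipschitz (\<lambda>u. c)"
  by (rule bounded_lipschitzI[where B = "\<bar>c\<bar>" and C = 0]) auto

lemma bounded_lipschitz_ident: "bounded_lipschitz (\<lambda>u. u)"
  by (rule bounded_lipschitzI[where B = 1 and C = 1]) auto

lemma bounded_lipschitz_add:
  assumes "bounded_lipschitz f" "bounded_lipschitz g"
  shows "bounded_lipschitz (\<lambda>u. f u + g u)"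
proof -
  obtain C where C: "C \<ge> 0" "\<And>u. 0 \<le> u \<Longrightarrow> u \<le> 1 \<Longrightarrow> \<bar>f u\<bar> \<le> C"
    "\<And>u v. 0 \<le> u \<Longrightarrow> u \<le> 1 \<Longrightarrow> 0 \<le> v \<Longrightarrow> v \<le> 1 \<Longrightarrow> \<bar>f u - f v\<bar> \<le> C * \<bar>u - v\<bar>"
    using bounded_lipschitzE[OF assms(1)] by blast
  obtain D where D: "D \<ge> 0" "\<And>u. 0 \<le> u \<Longrightarrow> u \<le> 1 \<Longrightarrow> \<bar>g u\<bar> \<le> D"
    "\<And>u v. 0 \<le> u \<Longrightarrow> u \<le> 1 \<Longrightarrow> 0 \<le> v \<Longrightarrow> v \<le> 1 \<Longrightarrow> \<bar>g u - g v\<bar> \<le> D * \<bar>u - v\<bar>"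
    using bounded_lipschitzE[OF assms(2)] by blast
  show ?thesis
  proof (rule bounded_lipschitzI[where B = "C + D" and C = "C + D"])
    fix u :: real assume u: "0 \<le> u" "u \<le> 1"
    show "\<bar>f u + g u\<bar> \<le> C + D" using C(2)[OF u] D(2)[OF u] by linarith
    fix v :: real assume v: "0 \<le> v" "v \<le> 1"
    show "\<bar>f u + g u - (f v + g v)\<bar> \<le> (C + D) * \<bar>u - v\<bar>"
      using C(3)[OF u v] D(3)[OF u v] by (simp add: distrib_right)
  qed
qed

lemma bounded_lipschitz_mult:
  assumes "bounded_lipschitz f" "bounded_lipschitz g"
  shows "bounded_lipschitz (\<lambda>u. f u * g u)"
proof -
  obtain C where C: "C \<ge> 0" "\<And>u. 0 \<le> u \<Longrightarrow> u \<le> 1 \<Longrightarrow> \<bar>f u\<bar> \<le> C"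
    "\<And>u v. 0 \<le> u \<Longrightarrow> u \<le> 1 \<Longrightarrow> 0 \<le> v \<Longrightarrow> v \<le> 1 \<Longrightarrow> \<bar>f u - f v\<bar> \<le> C * \<bar>u - v\<bar>"
    using bounded_lipschitzE[OF assms(1)] by blast
  obtain D where D: "D \<ge> 0" "\<And>u. 0 \<le> u \<Longrightarrow> u \<le> 1 \<Longrightarrow> \<bar>g u\<bar> \<le> D"
    "\<And>u v. 0 \<le> u \<Longrightarrow> u \<le> 1 \<Longrightarrow> 0 \<le> v \<Longrightarrow> v \<le> 1 \<Longrightarrow> \<bar>g u - g v\<bar> \<le> D * \<bar>u - v\<bar>"
    using bounded_lipschitzE[OF assms(2)] by blast
  show ?thesis
  proof (rule bounded_lipschitzI[where B = "C * D" and C = "2 * (C * D)"])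
    fix u :: real assume u: "0 \<le> u" "u \<le> 1"
    show "\<bar>f u * g u\<bar> \<le> C * D" unfolding abs_mult using C(1,2) D(1,2) u by (intro mult_mono) auto
    fix v :: real assume v: "0 \<le> v" "v \<le> 1"
    have "\<bar>f u * g u - f v * g v\<bar> = \<bar>(f u - f v) * g u + f v * (g u - g v)\<bar>"
      by (simp add: algebra_simps)
    also have "\<dots> \<le> \<bar>f u - f v\<bar> * \<bar>g u\<bar> + \<bar>f v\<bar> * \<bar>g u - g v\<bar>"
      by (metis abs_mult abs_triangle_ineq)
    also have "\<dots> \<le> (C * \<bar>u - v\<bar>) * D + C * (D * \<bar>u - v\<bar>)"
      using C D u v by (intro add_mono mult_mono) auto
    finally show "\<bar>f u * g u - f v * g v\<bar> \<le> 2 * (C * D) * \<bar>u - v\<bar>" by (simp add: algebra_simps)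
  qed
qed

lemma bounded_lipschitz_sum:
  assumes "\<And>i. i \<in> I \<Longrightarrow> bounded_lipschitz (f i)"
  shows "bounded_lipschitz (\<lambda>u. \<Sum>i\<in>I. f i u)"
  using assms
  by (induction I rule: infinite_finite_induct)
     (auto intro: bounded_lipschitz_const bounded_lipschitz_add)

lemma bounded_lipschitz_power: "bounded_lipschitz (\<lambda>u. u ^ n)"
  by (induction n)
     (auto intro: bounded_lipschitz_const bounded_lipschitz_ident bounded_lipschitz_mult)

lemma bounded_lipschitz_inverse:
  assumes "bounded_lipschitz f" and ge1: "\<And>u. 0 \<le> u \<Longrightarrow> u \<le> 1 \<Longrightarrow> f u \<ge> 1"
  shows "bounded_lipschitz (\<lambda>u. inverse (f u))"
proof -
  obtain C where C: "C \<ge> 0" "\<And>u. 0 \<le> u \<Longrightarrow> u \<le> 1 \<Longrightarrow> \<bar>f u\<bar> \<le> C"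
    "\<And>u v. 0 \<le> u \<Longrightarrow> u \<le> 1 \<Longrightarrow> 0 \<le> v \<Longrightarrow> v \<le> 1 \<Longrightarrow> \<bar>f u - f v\<bar> \<le> C * \<bar>u - v\<bar>"
    using bounded_lipschitzE[OF assms(1)] by blast
  show ?thesis
  proof (rule bounded_lipschitzI[where B = 1 and C = C])
    fix u :: real assume u: "0 \<le> u" "u \<le> 1"
    show "\<bar>inverse (f u)\<bar> \<le> 1" using ge1[OF u] by (simp add: inverse_le_1_iff)
    fix v :: real assume v: "0 \<le> v" "v \<le> 1"
    have fg: "f u \<ge> 1" "f v \<ge> 1" using ge1 u v by auto
    have "\<bar>inverse (f u) - inverse (f v)\<bar> = \<bar>f v - f u\<bar> / (f u * f v)"
      using fg by (simp add: field_simps abs_mult)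
    also have "\<dots> \<le> \<bar>f v - f u\<bar> / 1"
      using fg mult_mono[of 1 "f u" 1 "f v"] by (intro divide_left_mono) auto
    finally show "\<bar>inverse (f u) - inverse (f v)\<bar> \<le> C * \<bar>u - v\<bar>"
      using C(3)[OF u v] by (simp add: abs_minus_commute)
  qed
qed

text \<open>Grouping by periods gives \<open>P / (1 - u ^ N)\<close>, where \<open>P\<close> is the
  sum over one period. As a polynomial in \<open>u\<close> it vanishes at 1, so a factor
  \<open>1 - u\<close> cancels and the remaining denominator is at least 1 on the unit
  interval.\<close>

lemma periodic_power_series_sums:
  fixes H :: "nat \<Rightarrow> real"
  assumes N: "N > 0" and per: "\<And>e. H (e + N) = H e" and zero: "(\<Sum>e<N. H e) = 0"
    and u: "0 < u" "u < 1"
  shows "(\<lambda>e. H e * u ^ Suc e) sums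
     (- (\<Sum>e<N. H e * (\<Sum>i<Suc e. u ^ i)) * inverse (\<Sum>i<N. u ^ i))" (is "_ sums ?g")
    and "summable (\<lambda>e. norm (H e * u ^ Suc e))"
proof -
  have perk: "H (j * N + e) = H e" for j e
  proof (induction j)
    case (Suc j)
    have "H (Suc j * N + e) = H ((j * N + e) + N)" by (simp add: algebra_simps)
    then show ?case using Suc per by simp
  qed simp
  have Hb: "\<bar>H e\<bar> \<le> (\<Sum>i<N. \<bar>H i\<bar>)" for e
  proof -
    have "H e = H (e mod N)" using perk[of "e div N" "e mod N"] by simp
    moreover have "\<bar>H (e mod N)\<bar> \<le> (\<Sum>i<N. \<bar>H i\<bar>)" using N by (intro member_le_sum) auto
    ultimately show ?thesis by simp
  qed
  have geo: "summable (\<lambda>e. (\<Sum>i<N. \<bar>H i\<bar>) * u ^ Suc e)"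
    using u by (intro summable_mult summable_Suc_iff[THEN iffD2] summable_geometric) auto
  show ns: "summable (\<lambda>e. norm (H e * u ^ Suc e))"
  proof (rule summable_comparison_test'[OF geo])
    fix e show "norm (norm (H e * u ^ Suc e)) \<le> (\<Sum>i<N. \<bar>H i\<bar>) * u ^ Suc e"
      using Hb[of e] u by (simp add: abs_mult mult_right_mono)
  qed
  then have "summable (\<lambda>e. H e * u ^ Suc e)" by (rule summable_norm_cancel)
  then obtain s where s: "(\<lambda>e. H e * u ^ Suc e) sums s" by (auto simp: summable_def)
  define P where "P = (\<Sum>e<N. H e * u ^ Suc e)"
  have uN: "u ^ N < 1" using u N by (simp add: power_less_one_iff)
  have block: "(\<Sum>e=j*N..<j*N+N. H e * u ^ Suc e) = P * (u ^ N) ^ j" for j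
  proof -
    have "(\<Sum>e=j*N..<j*N+N. H e * u ^ Suc e) = (\<Sum>e<N. H (e + j*N) * u ^ Suc (e + j*N))"
      using sum.shift_bounds_nat_ivl[of "\<lambda>e. H e * u ^ Suc e" 0 "j*N" N]
      by (simp add: atLeast0LessThan add.commute)
    also have "\<dots> = P * (u ^ N) ^ j"
      unfolding P_def sum_distrib_right
    proof (intro sum.cong refl)
      fix e
      have "u ^ Suc (e + j*N) = u ^ Suc e * (u ^ N) ^ j"
        by (simp add: power_add power_mult[symmetric] mult.commute[of j])
      then show "H (e + j*N) * u ^ Suc (e + j*N) = H e * u ^ Suc e * (u ^ N) ^ j"
        using perk[of j e] by (simp add: add.commute)
    qed
    finally show ?thesis .
  qed
  have "(\<lambda>j. P * (u ^ N) ^ j) sums s" using sums_group[OF s N] block by simp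
  moreover have "(\<lambda>j. P * (u ^ N) ^ j) sums (P * (1 / (1 - u ^ N)))"
    using uN u by (intro sums_mult geometric_sums) auto
  ultimately have sP: "s = P / (1 - u ^ N)" using sums_unique2 by fastforce
  \<comment> \<open>Subtracting the vanishing sum of \<open>H\<close> turns every power
    \<open>u ^ Suc e\<close> into \<open>u ^ Suc e - 1\<close>, which is divisible by
    \<open>1 - u\<close>.\<close>
  have "P = (\<Sum>e<N. H e * u ^ Suc e) - (\<Sum>e<N. H e)" using zero by (simp add: P_def)
  also have "\<dots> = (\<Sum>e<N. - ((1 - u) * (H e * (\<Sum>i<Suc e. u ^ i))))"
    unfolding sum_subtractf[symmetric]
  proof (intro sum.cong refl)
    fix e
    have "1 - u ^ Suc e = (1 - u) * (\<Sum>i<Suc e. u ^ i)" by (rule one_diff_power_eq)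
    then show "H e * u ^ Suc e - H e = - ((1 - u) * (H e * (\<Sum>i<Suc e. u ^ i)))"
      by (metis (no_types, opaque_lifting) minus_diff_eq mult.left_commute mult.right_neutral right_diff_distrib)
  qed
  finally have P2: "P = - (1 - u) * (\<Sum>e<N. H e * (\<Sum>i<Suc e. u ^ i))"
    by (simp only: sum_negf sum_distrib_left mult_minus_left)
  have "1 - u ^ N = (1 - u) * (\<Sum>i<N. u ^ i)" by (rule one_diff_power_eq)
  then have "s = ?g"
    unfolding sP P2 using u
    by (simp only: mult_minus_left mult_minus_right[symmetric] mult_divide_mult_cancel_left) (simp add: divide_inverse)
  with s show "(\<lambda>e. H e * u ^ Suc e) sums ?g" by simp
qed

text \<open>Summing over \<^term>\<open>e\<close> first gives \<^term>\<open>g d (t ^ d)\<close> with \<^term>\<open>g d\<close>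
  Lipschitz on the unit interval, because the pole at 1 cancels; the sum over a period of
  \<^term>\<open>d\<close> is then bounded by the decrease of \<^term>\<open>t ^ d\<close> over that period.\<close>

lemma balanced_lambert_bounded:
  fixes h :: "nat \<Rightarrow> nat \<Rightarrow> real"
  assumes N: "N > 0"
    and per1: "\<And>d e. h (d + N) e = h d e" and per2: "\<And>d e. h d (e + N) = h d e"
    and zero1: "\<And>e. (\<Sum>d<N. h d e) = 0" and zero2: "\<And>d. (\<Sum>e<N. h d e) = 0"
  shows "\<exists>C. \<forall>t s. 0 < t \<longrightarrow> t < 1 \<longrightarrow>
     ((\<lambda>(d, e). h d e * t ^ (Suc d * Suc e)) has_sum s) UNIV \<longrightarrow> \<bar>s\<bar> \<le> C"
proof -
  define g where "g d u = - (\<Sum>e<N. h d e * (\<Sum>i<Suc e. u ^ i)) * inverse (\<Sum>i<N. u ^ i)" for d and u :: real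
  have "bounded_lipschitz (g d)" for d
  proof -
    have "(\<Sum>i<N. u ^ i) \<ge> 1" if "0 \<le> u" for u :: real
      using member_le_sum[of 0 "{..<N}" "\<lambda>i. u ^ i"] N that by simp
    moreover have "g d = (\<lambda>u. - 1 * (\<Sum>e<N. h d e * (\<Sum>i<Suc e. u ^ i)) * inverse (\<Sum>i<N. u ^ i))"
      by (simp add: g_def fun_eq_iff)
    ultimately show ?thesis
      by (simp only:) (intro bounded_lipschitz_mult bounded_lipschitz_sum bounded_lipschitz_const
        bounded_lipschitz_power bounded_lipschitz_inverse, auto)
  qed
  then have "\<forall>d. \<exists>C\<ge>0. \<forall>u v. 0 \<le> u \<longrightarrow> u \<le> 1 \<longrightarrow> 0 \<le> v \<longrightarrow> v \<le> 1 \<longrightarrow> \<bar>g d u - g d v\<bar> \<le> C * \<bar>u - v\<bar>"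
    by (meson bounded_lipschitzE)
  then obtain K where K: "\<And>d. K d \<ge> 0"
    "\<And>d u v. 0 \<le> u \<Longrightarrow> u \<le> 1 \<Longrightarrow> 0 \<le> v \<Longrightarrow> v \<le> 1 \<Longrightarrow> \<bar>g d u - g d v\<bar> \<le> K d * \<bar>u - v\<bar>"
    by metis
  define C where "C = (\<Sum>d<N. K d)"
  have hperk: "h (j * N + d) = h d" for j d
  proof (induction j)
    case (Suc j)
    have "h (Suc j * N + d) = h ((j * N + d) + N)" by (simp add: algebra_simps)
    then show ?case using Suc per1 by (simp add: fun_eq_iff)
  qed simp
  have gper: "g (j * N + d) = g d" for j d by (simp add: g_def hperk fun_eq_iff)
  have gzero: "(\<Sum>d<N. g d u) = 0" for u
  proof -
    have "(\<Sum>d<N. \<Sum>e<N. h d e * (\<Sum>i<Suc e. u ^ i)) = (\<Sum>e<N. (\<Sum>d<N. h d e) * (\<Sum>i<Suc e. u ^ i))"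
      by (subst sum.swap) (simp add: sum_distrib_right)
    then show ?thesis
      by (simp add: g_def zero1 sum_negf flip: sum_distrib_right)
  qed
  show ?thesis
  proof (intro exI[of _ C] allI impI)
    fix t s :: real
    assume t: "0 < t" "t < 1"
      and hs: "((\<lambda>(d, e). h d e * t ^ (Suc d * Suc e)) has_sum s) UNIV"
    have inner: "((\<lambda>e. h d e * t ^ (Suc d * Suc e)) has_sum g d (t ^ Suc d)) UNIV" for d
    proof -
      have u: "0 < t ^ Suc d" "t ^ Suc d < 1" using t by (auto simp: power_Suc_less_one simp del: power_Suc)
      have *: "(t ^ Suc d) ^ Suc e = t ^ (Suc d * Suc e)" for e by (simp only: power_mult)
      show ?thesis
        using periodic_power_series_sums[of N "h d" "t ^ Suc d", OF N per2 zero2 u]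
        unfolding * g_def by (intro norm_summable_imp_has_sum)
    qed
    have "((\<lambda>d. g d (t ^ Suc d)) has_sum s) UNIV"
      using has_sum_Sigma'[where f = "\<lambda>(d, e). h d e * t ^ (Suc d * Suc e)" and a = s and A = UNIV
          and B = "\<lambda>_. UNIV" and b = "\<lambda>d. g d (t ^ Suc d)"]
        hs inner by simp
    then have "(\<lambda>d. g d (t ^ Suc d)) sums s" by (rule has_sum_imp_sums)
    from sums_group[OF this N]
    have grp: "(\<lambda>j. \<Sum>d=j*N..<j*N+N. g d (t ^ Suc d)) sums s" .
    have bnd: "\<bar>\<Sum>d=j*N..<j*N+N. g d (t ^ Suc d)\<bar> \<le> C * ((t ^ N) ^ j - (t ^ N) ^ Suc j)" for j
    proof -
      have "(\<Sum>d=j*N..<j*N+N. g d (t ^ Suc d)) = (\<Sum>r<N. g (r + j*N) (t ^ Suc (r + j*N)))"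
        using sum.shift_bounds_nat_ivl[of "\<lambda>d. g d (t ^ Suc d)" 0 "j*N" N]
        by (simp add: atLeast0LessThan add.commute)
      \<comment> \<open>By \<open>gzero\<close> the values of all \<open>g r\<close> at the common
        point \<open>t ^ (j*N)\<close> can be subtracted, so that only differences remain and the
        Lipschitz bound applies.\<close>
      also have "\<dots> = (\<Sum>r<N. g r (t ^ Suc (j*N + r)) - g r (t ^ (j*N)))"
        unfolding sum_subtractf gzero by (simp add: add.commute[of _ "j*N"] gper)
      also have "\<bar>\<dots>\<bar> \<le> (\<Sum>r<N. K r * (t ^ (j*N) - t ^ (j*N + N)))"
      proof (intro order.trans[OF sum_abs] sum_mono)
        fix r assume r: "r \<in> {..<N}"
        \<comment> \<open>Since \<open>r < N\<close>, the exponent \<open>Suc (j*N + r)\<close>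
          stays within the block from \<open>j*N\<close> to \<open>j*N + N\<close>.\<close>
        have le: "t ^ (j*N + N) \<le> t ^ Suc (j*N + r)" "t ^ Suc (j*N + r) \<le> t ^ (j*N)"
          using t r by (auto intro!: power_decreasing simp del: power_Suc)
        have "\<bar>g r (t ^ Suc (j*N + r)) - g r (t ^ (j*N))\<bar> \<le> K r * \<bar>t ^ Suc (j*N + r) - t ^ (j*N)\<bar>"
          using t by (intro K(2)) (auto intro!: power_le_one simp del: power_Suc)
        also have "\<dots> \<le> K r * (t ^ (j*N) - t ^ (j*N + N))"
          using le K(1) by (intro mult_left_mono) auto
        finally show "\<bar>g r (t ^ Suc (j*N + r)) - g r (t ^ (j*N))\<bar> \<le> K r * (t ^ (j*N) - t ^ (j*N + N))" .
      qed
      also have "\<dots> = C * ((t ^ N) ^ j - (t ^ N) ^ Suc j)"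
        by (simp add: C_def sum_distrib_right power_add mult.commute flip: power_mult)
      finally show ?thesis .
    qed
    have tN: "0 < t ^ N" "t ^ N < 1" using t N by (auto simp: power_less_one_iff)
    \<comment> \<open>The block bounds telescope to \<open>C\<close>, whatever the value of
      \<open>t\<close>.\<close>
    have "(\<lambda>j. (t ^ N) ^ j - (t ^ N) ^ Suc j) sums ((t ^ N) ^ 0 - 0)"
      using tN by (intro telescope_sums' LIMSEQ_realpow_zero) auto
    then have tel: "(\<lambda>j. C * ((t ^ N) ^ j - (t ^ N) ^ Suc j)) sums (C * 1)"
      by (intro sums_mult) simp
    show "\<bar>s\<bar> \<le> C"
      using norm_sums_le[OF grp tel] bnd by simp
  qed
qed

section \<open>Real characters in residue classes\<close>

lemma sum_divisors_coprime_mult: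
  fixes f :: "nat \<Rightarrow> int"
  assumes mult: "\<And>a b. f (a * b) = f a * f b" and "coprime m n" "m > 0" "n > 0"
  shows "(\<Sum>d | d dvd m * n. f d) = (\<Sum>d | d dvd m. f d) * (\<Sum>d | d dvd n. f d)"
proof -
  have inj: "inj_on (\<lambda>(x, y). x * y) ({d. d dvd m} \<times> {d. d dvd n})"
  proof (rule inj_onI, clarsimp)
    fix x y x' y' assume d: "x dvd m" "y dvd n" "x' dvd m" "y' dvd n" and eq: "x * y = x' * y'"
    have "coprime x y'" "coprime x' y"
      using d assms(2) by (meson coprime_divisors)+
    then have "x dvd x'" "x' dvd x"
      using eq by (metis coprime_dvd_mult_left_iff dvd_triv_left)+
    then have "x = x'" by (rule dvd_antisym)
    moreover have "x > 0" using d assms by (auto intro!: Nat.gr0I)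
    ultimately show "x = x' \<and> y = y'" using eq by simp
  qed
  have img: "(\<lambda>(x, y). x * y) ` ({d. d dvd m} \<times> {d. d dvd n}) = {d. d dvd m * n}"
  proof (intro equalityI subsetI)
    fix d assume "d \<in> {d. d dvd m * n}"
    then obtain x y where "d = x * y" "x dvd m" "y dvd n" by (auto elim: dvd_productE)
    then show "d \<in> (\<lambda>(x, y). x * y) ` ({d. d dvd m} \<times> {d. d dvd n})" by force
  qed (auto intro: mult_dvd_mono)
  have "(\<Sum>d | d dvd m * n. f d) = (\<Sum>(x, y)\<in>{d. d dvd m} \<times> {d. d dvd n}. f x * f y)"
    unfolding img[symmetric] by (subst sum.reindex[OF inj]) (simp add: mult case_prod_beta' comp_def)
  then show ?thesis by (simp add: sum_product sum.cartesian_product)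
qed

lemma sum_divisors_prime_power_mult:
  fixes f :: "nat \<Rightarrow> int"
  assumes mult: "\<And>a b. f (a * b) = f a * f b" and one: "f 1 = 1"
    and p: "prime p" and b: "\<not> p dvd b"
  shows "(\<Sum>d | d dvd p ^ k * b. f d) = (\<Sum>i\<le>k. f p ^ i) * (\<Sum>d | d dvd b. f d)"
proof -
  have pw: "f (p ^ i) = f p ^ i" for i by (induction i) (simp_all add: mult one[simplified])
  have "coprime (p ^ k) b" using p b by (simp add: prime_imp_coprime coprime_power_left_iff)
  moreover have "b > 0" using b by (auto intro!: Nat.gr0I)
  ultimately have "(\<Sum>d | d dvd p ^ k * b. f d) = (\<Sum>d | d dvd p ^ k. f d) * (\<Sum>d | d dvd b. f d)"
    using p by (intro sum_divisors_coprime_mult mult) (auto simp: prime_gt_0_nat)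
  also have "{d. d dvd p ^ k} = (\<lambda>i. p ^ i) ` {..k}" using p by (auto simp: divides_primepow_nat)
  also have "(\<Sum>d\<in>(\<lambda>i. p ^ i) ` {..k}. f d) = (\<Sum>i\<le>k. f p ^ i)"
    using p by (subst sum.reindex) (auto simp: inj_on_def pw power_inject_exp dest: prime_gt_1_nat)
  finally show ?thesis .
qed

text \<open>These sums are the local factors of a divisor sum at a prime power: 1 for value 0,
  \<open>k + 1\<close> for value 1, and 1 or 0 by the parity of \<open>k\<close> for value -1. The
  vanishing case later excludes character value -1 at primes of odd exponent.\<close>

lemma sum_powers_sign:
  assumes "x \<in> {-1, 0, 1 :: int}"
  shows "(\<Sum>i\<le>k. x ^ i) \<ge> 0" and "even k \<Longrightarrow> (\<Sum>i\<le>k. x ^ i) > 0"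
    and "odd k \<Longrightarrow> x = -1 \<Longrightarrow> (\<Sum>i\<le>k. x ^ i) = 0"
proof -
  have m1: "(\<Sum>i\<le>k. (-1 :: int) ^ i) = (if even k then 1 else 0)" by (induction k) auto
  have 0: "(\<Sum>i\<le>k. (0 :: int) ^ i) = 1" by (induction k) auto
  show "(\<Sum>i\<le>k. x ^ i) \<ge> 0" and "even k \<Longrightarrow> (\<Sum>i\<le>k. x ^ i) > 0"
    and "odd k \<Longrightarrow> x = -1 \<Longrightarrow> (\<Sum>i\<le>k. x ^ i) = 0"
    using assms m1 0 by auto
qed

text \<open>The sum is the product of its local factors, all nonnegative; a square has only even
  exponents, for which each factor is positive. The induction splits off the full power of one
  prime.\<close>

lemma sum_divisors_real_character:
  fixes f :: "nat \<Rightarrow> int"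
  assumes mult: "\<And>a b. f (a * b) = f a * f b" and one: "f 1 = 1"
    and vals: "\<And>a. f a \<in> {-1, 0, 1}" and "a > 0"
  shows "(\<Sum>d | d dvd a. f d) \<ge> 0" and "\<exists>k. a = k\<^sup>2 \<Longrightarrow> (\<Sum>d | d dvd a. f d) > 0"
proof -
  have "(\<Sum>d | d dvd a. f d) \<ge> 0 \<and> ((\<exists>k. a = k\<^sup>2) \<longrightarrow> (\<Sum>d | d dvd a. f d) > 0)"
    using \<open>a > 0\<close>
  proof (induction a rule: less_induct)
    case (less a)
    show ?case
    proof (cases "a = 1")
      case True then show ?thesis using one by simp
    next
      case False
      then obtain p where p: "prime p" "p dvd a" using prime_factor_nat by blast
      define k where "k = multiplicity p a"
      have nu: "\<not> is_unit p" using p(1) not_prime_unit by blast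
      obtain b where b: "a = p ^ k * b" "\<not> p dvd b"
        using multiplicity_decompose'[OF _ nu, of a] less.prems unfolding k_def by blast
      have "k > 0" unfolding k_def using p less.prems by (simp add: prime_multiplicity_gt_zero_iff)
      have "b > 0" using b less.prems by (auto intro!: Nat.gr0I)
      moreover have "b < a" using b(1) \<open>k > 0\<close> \<open>b > 0\<close> one_less_power[OF prime_gt_1_nat[OF p(1)]] by simp
      ultimately have IH: "(\<Sum>d | d dvd b. f d) \<ge> 0" "(\<exists>k. b = k\<^sup>2) \<Longrightarrow> (\<Sum>d | d dvd b. f d) > 0"
        using less.IH by blast+
      have eq: "(\<Sum>d | d dvd a. f d) = (\<Sum>i\<le>k. f p ^ i) * (\<Sum>d | d dvd b. f d)"
        unfolding b(1) by (rule sum_divisors_prime_power_mult[OF mult one p(1) b(2)])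
      show ?thesis
      proof (intro conjI impI)
        show "(\<Sum>d | d dvd a. f d) \<ge> 0"
          unfolding eq using sum_powers_sign(1)[OF vals] IH by simp
        assume "\<exists>l. a = l\<^sup>2"
        then obtain l where l: "a = l\<^sup>2" by blast
        then have "l > 0" using less.prems by (auto intro!: Nat.gr0I)
        have ek: "k = 2 * multiplicity p l"
          unfolding k_def l using p \<open>l > 0\<close> by (simp add: prime_elem_multiplicity_power_distrib)
        obtain c where c: "l = p ^ multiplicity p l * c"
          using multiplicity_decompose'[OF _ nu, of l] \<open>l > 0\<close> by blast
        have "p ^ k * b = p ^ k * c\<^sup>2"
          using b(1) l c ek by (metis power_even_eq power_mult_distrib mult.commute)
        then have "b = c\<^sup>2" using p(1) by (simp add: prime_gt_0_nat)
        then show "(\<Sum>d | d dvd a. f d) > 0"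
          unfolding eq using sum_powers_sign(2)[OF vals, of k p] IH(2) ek by auto
      qed
    qed
  qed
  then show "(\<Sum>d | d dvd a. f d) \<ge> 0" and "\<exists>k. a = k\<^sup>2 \<Longrightarrow> (\<Sum>d | d dvd a. f d) > 0" by blast+
qed

text \<open>As \<open>e\<close> runs below \<open>N\<close>, \<open>Suc e\<close> runs through all
  residues, and multiplication by the unit \<open>D\<close> permutes them.\<close>

lemma card_residue_solutions:
  assumes "coprime D N" "N > 0"
  shows "card {e \<in> {..<N}. [D * Suc e = c] (mod N)} = (1 :: nat)"
proof -
  have inj: "inj_on (\<lambda>e. D * Suc e mod N) {..<N}"
  proof (rule inj_onI)
    fix x y assume xy: "x \<in> {..<N}" "y \<in> {..<N}" "D * Suc x mod N = D * Suc y mod N"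
    then have "[D * Suc x = D * Suc y] (mod N)" unfolding cong_def by blast
    then have "[Suc x = Suc y] (mod N)" using cong_mult_lcancel_nat[OF assms(1)] by blast
    then have "[x = y] (mod N)" using cong_add_rcancel_nat[of x 1 y N] by simp
    then show "x = y" using xy by (simp add: cong_def)
  qed
  moreover have sub: "(\<lambda>e. D * Suc e mod N) ` {..<N} \<subseteq> {..<N}" using assms by auto
  ultimately have "(\<lambda>e. D * Suc e mod N) ` {..<N} = {..<N}"
    by (intro endo_inj_surj) auto
  moreover have "c mod N \<in> {..<N}" using assms by simp
  ultimately have "c mod N \<in> (\<lambda>e. D * Suc e mod N) ` {..<N}" by (simp only:)
  then obtain e where e: "e \<in> {..<N}" "c mod N = D * Suc e mod N" by (rule imageE)
  have "x = e" if "x \<in> {..<N}" "[D * Suc x = c] (mod N)" for x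
    by (rule inj_onD[OF inj _ that(1) e(1)]) (use that(2) e(2) in \<open>simp only: cong_def\<close>)
  moreover have "[D * Suc e = c] (mod N)" unfolding cong_def using e(2) by (rule sym)
  ultimately have "{e \<in> {..<N}. [D * Suc e = c] (mod N)} = {e}" using e(1) by blast
  then show ?thesis by (simp only:) simp
qed

lemma power_product_summable:
  fixes t :: real
  assumes "0 < t" "t < 1"
  shows "(\<lambda>(d, e). t ^ (Suc d * Suc e)) summable_on UNIV"
proof -
  have geo: "((\<lambda>e. t ^ e) has_sum (1 / (1 - t))) UNIV"
    using assms geometric_sums[of t] by (intro norm_summable_imp_has_sum) (auto simp: norm_power)
  have "(\<lambda>(d, e). t ^ d * t ^ e) summable_on (SIGMA d:UNIV. UNIV)"
  proof (rule summable_on_SigmaI)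
    fix d show "((\<lambda>e. case (d, e) of (d, e) \<Rightarrow> t ^ d * t ^ e) has_sum t ^ d * (1 / (1 - t))) UNIV"
      using has_sum_cmult_right[OF geo] by simp
    show "(\<lambda>d. t ^ d * (1 / (1 - t))) summable_on UNIV"
      using has_sum_imp_summable[OF geo] by (rule summable_on_cmult_left)
  qed (use assms in auto)
  then have "(\<lambda>(d, e). t ^ d * t ^ e) summable_on UNIV" by simp
  then show ?thesis
  proof (rule summable_on_comparison_test)
    fix x :: "nat \<times> nat"
    obtain d e where x: "x = (d, e)" by force
    \<comment> \<open>The inequality \<open>(d + 1) * (e + 1) >= d + e\<close> allows comparison
      with a product of two geometric series.\<close>
    have "t ^ (Suc d * Suc e) \<le> t ^ (d + e)"
      using assms by (intro power_decreasing) auto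
    then show "(case x of (d, e) \<Rightarrow> t ^ (Suc d * Suc e)) \<le> (case x of (d, e) \<Rightarrow> t ^ d * t ^ e)"
      unfolding x by (simp only: power_add prod.case)
  qed (use assms in auto)
qed

text \<open>Suppose that no divisor sum in the class of \<open>c\<close> is positive. Then the
  series over that class is at most 0, while the series over the class of 1 grows without bound
  because of the squares; this contradicts the bounded difference.\<close>

lemma real_character_progression:
  fixes f :: "nat \<Rightarrow> int"
  assumes N: "N > 0"
    and mult: "\<And>a b. f (a * b) = f a * f b"
    and cong: "\<And>a b. [a = b] (mod N) \<Longrightarrow> f a = f b"
    and unit: "\<And>a. coprime a N \<Longrightarrow> f a = 1 \<or> f a = -1"
    and nonunit: "\<And>a. \<not> coprime a N \<Longrightarrow> f a = 0"
    and one: "f 1 = 1"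
    and c: "coprime c N" "f c = 1"
  shows "\<exists>a>0. [a = c] (mod N) \<and> (\<Sum>d | d dvd a. f d) > 0"
proof (rule ccontr)
  assume "\<not> ?thesis"
  then have neg: "(\<Sum>d | d dvd a. f d) \<le> 0" if "a > 0" "[a = c] (mod N)" for a
    using that by force
  have vals: "f a \<in> {-1, 0, 1}" for a using unit nonunit by blast
  define \<delta> :: "nat \<Rightarrow> nat \<Rightarrow> real" where "\<delta> b a = of_bool ([a = b] (mod N))" for b a
  \<comment> \<open>Indices start at 0, so \<open>Suc d\<close> and \<open>Suc e\<close> stand for
    the two divisors. The weight is balanced in both variables because \<open>f\<close> takes the
    value 1 at \<open>c\<close> and at 1.\<close>
  define h where "h d e = of_int (f (Suc d)) * (\<delta> c (Suc d * Suc e) - \<delta> 1 (Suc d * Suc e))" for d e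
  have count: "(\<Sum>e<N. \<delta> b (D * Suc e)) = 1" if "coprime D N" for b D
  proof -
    have "(\<Sum>e<N. \<delta> b (D * Suc e)) = real (card {e \<in> {..<N}. [D * Suc e = b] (mod N)})"
      by (simp add: \<delta>_def Int_def)
    then show ?thesis using card_residue_solutions[OF that N] by simp
  qed
  have \<delta>cong: "\<delta> b x = \<delta> b y" if "[x = y] (mod N)" for b x y
    using that by (simp add: \<delta>_def cong_def)
  have "\<exists>C. \<forall>t s. 0 < t \<longrightarrow> t < 1 \<longrightarrow>
     ((\<lambda>(d, e). h d e * t ^ (Suc d * Suc e)) has_sum s) UNIV \<longrightarrow> \<bar>s\<bar> \<le> C"
  proof (rule balanced_lambert_bounded[OF N])
    fix d e
    have "[Suc (d + N) = Suc d] (mod N)" "[Suc (e + N) = Suc e] (mod N)"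
      by (simp_all add: cong_def flip: add_Suc)
    then show "h (d + N) e = h d e" "h d (e + N) = h d e"
      unfolding h_def
      using cong[OF \<open>[Suc (d + N) = Suc d] (mod N)\<close>]
        \<delta>cong[OF cong_mult[OF \<open>[Suc (d + N) = Suc d] (mod N)\<close> cong_refl]]
        \<delta>cong[OF cong_mult[OF cong_refl \<open>[Suc (e + N) = Suc e] (mod N)\<close>]]
      by (simp_all only:)
    show "(\<Sum>e<N. h d e) = 0"
    proof (cases "coprime (Suc d) N")
      case True
      then show ?thesis
        unfolding h_def sum_distrib_left[symmetric] sum_subtractf count[OF True] by simp
    qed (simp add: h_def nonunit)
    show "(\<Sum>d<N. h d e) = 0"
    proof (cases "coprime (Suc e) N")
      case True
      \<comment> \<open>If a product of two units has character value 1, its factors have equal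
        sign. So \<open>f (Suc d)\<close> may be replaced by \<open>f (Suc e)\<close>, which is
        constant in the sum over \<open>d\<close>.\<close>
      have *: "of_int (f (Suc d)) * \<delta> b (Suc d * Suc e) = of_int (f (Suc e)) * \<delta> b (Suc e * Suc d)"
        if "f b = 1" for b d
      proof (cases "[Suc d * Suc e = b] (mod N)")
        case eq: True
        have "f (Suc d) * f (Suc e) = 1" using cong[OF eq] that by (simp only: mult)
        then have "f (Suc d) = f (Suc e)" using unit[OF True] by auto
        then show ?thesis by (simp only: mult.commute[of "Suc d" "Suc e"])
      next
        case ne: False
        then have "\<delta> b (Suc d * Suc e) = 0" unfolding \<delta>_def by (simp only: of_bool_eq)
        then show ?thesis by (simp only: mult.commute[of "Suc e" "Suc d"] mult_zero_right)
      qed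
      have "(\<Sum>d<N. h d e) = (\<Sum>d<N. of_int (f (Suc e)) * \<delta> c (Suc e * Suc d) - of_int (f (Suc e)) * \<delta> 1 (Suc e * Suc d))"
        unfolding h_def right_diff_distrib by (simp only: *[OF c(2)] *[OF one])
      also have "\<dots> = 0"
        unfolding sum_subtractf sum_distrib_left[symmetric] count[OF True] by simp
      finally show ?thesis .
    next
      case False
      \<comment> \<open>A product with a factor not prime to \<open>N\<close> cannot lie in a class
        of units, so neither class is met.\<close>
      have "\<delta> b (Suc d * Suc e) = 0" if "coprime b N" for b d
      proof -
        have "\<not> [Suc d * Suc e = b] (mod N)"
        proof
          assume "[Suc d * Suc e = b] (mod N)"
          from cong_imp_coprime[OF cong_sym[OF this] that] have "coprime (Suc d * Suc e) N" .
          then show False using False coprime_mult_left_iff by blast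
        qed
        then show ?thesis unfolding \<delta>_def by (simp only: of_bool_eq)
      qed
      then show ?thesis using c(1) by (simp only: h_def coprime_1_left) simp
    qed
  qed
  then obtain C where C: "\<And>t s. 0 < t \<Longrightarrow> t < 1 \<Longrightarrow>
     ((\<lambda>(d, e). h d e * t ^ (Suc d * Suc e)) has_sum s) UNIV \<Longrightarrow> \<bar>s\<bar> \<le> C" by blast
  \<comment> \<open>The \<open>K\<close> squares \<open>(N * j + 1)\<^sup>2\<close> with
    \<open>j < K\<close> lie in the class of 1 and do not exceed \<open>B\<close>. As
    \<open>t ^ B\<close> is 1/2, each contributes at least 1/2, in total
    \<open>K / 2 > C\<close>.\<close>
  define K where "K = nat \<lceil>2 * C\<rceil> + 1"
  define B where "B = (N * K + 1)\<^sup>2"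
  define t where "t = root B (1/2)"
  have "B > 0" unfolding B_def by simp
  have tB: "t ^ B = 1 / 2" unfolding t_def using \<open>B > 0\<close> by (intro real_root_pow_pos2) auto
  have t: "0 < t" "t < 1" unfolding t_def using \<open>B > 0\<close> by auto
  define F where "F b = (\<lambda>(d, e). of_int (f (Suc d)) * \<delta> b (Suc d * Suc e) * t ^ (Suc d * Suc e))" for b
  define G where "G b = (\<lambda>a. \<delta> b a * of_int (\<Sum>d | d dvd a. f d) * t ^ a)" for b
  have FG: "\<exists>S. (F b has_sum S) UNIV \<and> (G b has_sum S) {0<..}" for b
  proof -
    have "F b summable_on UNIV"
    proof (rule abs_summable_summable, rule summable_on_comparison_test[OF power_product_summable[OF t]])
      fix x :: "nat \<times> nat"
      obtain d e where x: "x = (d, e)" by force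
      have "\<bar>real_of_int (f (Suc d)) * \<delta> b (Suc d * Suc e)\<bar> \<le> 1"
        using vals[of "Suc d"] by (auto simp: \<delta>_def)
      then show "norm (F b x) \<le> (case x of (d, e) \<Rightarrow> t ^ (Suc d * Suc e))"
        unfolding x F_def using t by (simp add: abs_mult mult_le_cancel_right1 del: mult_Suc mult_Suc_right)
    qed auto
    then obtain S where S: "(F b has_sum S) UNIV" by (auto simp: summable_on_def)
    \<comment> \<open>The double series is regrouped by the product
      \<open>a = Suc d * Suc e\<close>, with the first factor as divisor; the subtractions of 1 undo
      the index shift.\<close>
    have "((\<lambda>(a, d). of_int (f d) * \<delta> b a * t ^ a) has_sum S) (SIGMA a:{0<..}. {d. d dvd a})"
      using S unfolding F_def
      by (subst has_sum_reindex_bij_witness[where S = "SIGMA a:{0<..}. {d. d dvd a}" and T = UNIV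
         and j = "\<lambda>(a, d). (d - 1, a div d - 1)" and i = "\<lambda>(d, e). (Suc d * Suc e, Suc d)"])
        (auto elim!: dvdE simp del: mult_Suc mult_Suc_right)
    then have "((\<lambda>a. \<Sum>d | d dvd a. of_int (f d) * \<delta> b a * t ^ a) has_sum S) {0<..}"
      by (rule has_sum_SigmaD) (auto intro!: has_sum_finite)
    also have "(\<lambda>a. \<Sum>d | d dvd a. of_int (f d) * \<delta> b a * t ^ a) = G b"
      by (simp add: G_def fun_eq_iff sum_distrib_left sum_distrib_right mult_ac)
    finally show ?thesis using S by blast
  qed
  obtain Sc where Sc: "(F c has_sum Sc) UNIV" "(G c has_sum Sc) {0<..}" using FG by blast
  obtain S1 where S1: "(F 1 has_sum S1) UNIV" "(G 1 has_sum S1) {0<..}" using FG by blast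
  have "((\<lambda>x. F c x + - F 1 x) has_sum (Sc + - S1)) UNIV"
    using Sc(1) S1(1) by (intro has_sum_add has_sum_uminusI)
  also have "(\<lambda>x. F c x + - F 1 x) = (\<lambda>(d, e). h d e * t ^ (Suc d * Suc e))"
    by (auto simp: fun_eq_iff F_def h_def left_diff_distrib right_diff_distrib)
  finally have bound: "\<bar>Sc + - S1\<bar> \<le> C" using C t by blast
  have "Sc \<le> 0"
  proof (rule has_sum_mono[OF Sc(2) has_sum_0])
    fix a :: nat assume "a \<in> {0<..}"
    then have "\<delta> c a * of_int (\<Sum>d | d dvd a. f d) \<le> 0"
      using neg[of a] by (auto simp: \<delta>_def simp flip: of_int_sum)
    then show "G c a \<le> 0" unfolding G_def using t by (simp add: mult_nonpos_nonneg)
  qed auto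
  have "sum (G 1) ((\<lambda>j. (N * j + 1)\<^sup>2) ` {..<K}) \<le> S1"
  proof (rule finite_sum_le_has_sum[OF S1(2)])
    fix a :: nat assume "a \<in> {0<..} - (\<lambda>j. (N * j + 1)\<^sup>2) ` {..<K}"
    then have "(\<Sum>d | d dvd a. f d) \<ge> 0"
      using sum_divisors_real_character(1)[OF mult one vals] by simp
    then show "G 1 a \<ge> 0" unfolding G_def using t by (simp add: \<delta>_def flip: of_int_sum)
  qed auto
  moreover have "sum (G 1) ((\<lambda>j. (N * j + 1)\<^sup>2) ` {..<K}) = (\<Sum>j<K. G 1 ((N * j + 1)\<^sup>2))"
    using N by (subst sum.reindex) (auto simp: inj_on_def power2_eq_iff_nonneg)
  moreover have "(\<Sum>j<K. G 1 ((N * j + 1)\<^sup>2)) \<ge> (\<Sum>j<K. 1 / 2)"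
  proof (rule sum_mono)
    fix j assume j: "j \<in> {..<K}"
    let ?a = "(N * j + 1)\<^sup>2"
    have "(\<Sum>d | d dvd ?a. f d) > 0"
      by (intro sum_divisors_real_character(2)[OF mult one vals]) auto
    then have ge1: "real_of_int (\<Sum>d | d dvd ?a. f d) \<ge> 1" by linarith
    have "[N * j + 1 = 1] (mod N)"
      using cong_add[OF cong_mult_self_left[of N j] cong_refl[of 1]] by simp
    then have "[?a = 1\<^sup>2] (mod N)" by (rule cong_pow)
    then have "\<delta> 1 ?a = 1" by (simp add: \<delta>_def)
    moreover have "1 / 2 \<le> t ^ ?a"
      unfolding tB[symmetric] B_def using t j by (intro power_decreasing power_mono) auto
    ultimately have "1 / 2 \<le> 1 * t ^ ?a \<and> 1 * t ^ ?a \<le> real_of_int (\<Sum>d | d dvd ?a. f d) * t ^ ?a"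
      using ge1 mult_right_mono[OF ge1, of "t ^ ?a"] t by simp
    then show "1 / 2 \<le> G 1 ?a" unfolding G_def \<open>\<delta> 1 ?a = 1\<close> by linarith
  qed
  moreover have "real K > 2 * C" unfolding K_def by linarith
  moreover have "(\<Sum>j<K. 1 / 2 :: real) = real K / 2" by simp
  ultimately show False using bound \<open>Sc \<le> 0\<close> by linarith
qed

section \<open>Quadratic characters\<close>

lemma Legendre_values: "Legendre a p \<in> {-1, 0, 1}"
  by (simp add: Legendre_def)

lemma Legendre_eq_0_iff: "Legendre a p = 0 \<longleftrightarrow> p dvd a"
  by (simp add: Legendre_def cong_0_iff)

lemma Legendre_eq_1_iff: "\<not> p dvd a \<Longrightarrow> Legendre a p = 1 \<longleftrightarrow> QuadRes p a"
  by (simp add: Legendre_def cong_0_iff)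

lemma Legendre_cong: "[a = b] (mod p) \<Longrightarrow> Legendre a p = Legendre b p"
  by (simp add: Legendre_def QuadRes_def cong_def)

text \<open>Two elements of {-1, 0, 1} differ by at most 2, hence by less than \<open>p\<close>, so
  a congruence such as Euler's criterion determines the symbol.\<close>

lemma Legendre_eqI:
  fixes p :: nat
  assumes "p > 2" "[Legendre a p = x] (mod p)" "x \<in> {-1, 0, 1}"
  shows "Legendre a p = x"
proof -
  have "int p dvd Legendre a p - x" using assms(2) by (simp add: cong_iff_dvd_diff)
  moreover have "\<bar>Legendre a p - x\<bar> < int p"
    using assms(1,3) Legendre_values[of a p] by auto
  ultimately show ?thesis using dvd_imp_le_int[of "Legendre a p - x" "int p"] by fastforce
qed

lemma Legendre_mult:
  fixes p :: nat
  assumes "prime p" "p > 2"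
  shows "Legendre (a * b) p = Legendre a p * Legendre b p"
proof (rule Legendre_eqI[OF assms(2)])
  have "[Legendre (a * b) p = a ^ ((p - 1) div 2) * b ^ ((p - 1) div 2)] (mod p)"
    using euler_criterion[OF assms, of "a * b"] by (simp add: power_mult_distrib)
  moreover have "[Legendre a p * Legendre b p = a ^ ((p - 1) div 2) * b ^ ((p - 1) div 2)] (mod p)"
    by (intro cong_mult euler_criterion assms)
  ultimately show "[Legendre (a * b) p = Legendre a p * Legendre b p] (mod p)"
    using cong_trans cong_sym by blast
  show "Legendre a p * Legendre b p \<in> {-1, 0, 1}"
    using Legendre_values[of a p] Legendre_values[of b p] by auto
qed

lemma Legendre_minus_one:
  fixes p :: nat
  assumes "prime p" "p > 2"
  shows "Legendre (-1) p = (if p mod 4 = 1 then 1 else -1)"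
proof -
  have "odd p" using assms prime_odd_nat by auto
  then have "p mod 4 = 1 \<and> even ((p - 1) div 2) \<or> p mod 4 = 3 \<and> odd ((p - 1) div 2)"
    by presburger
  then show ?thesis
    using Legendre_eqI[OF assms(2) euler_criterion[OF assms, of "-1"]] by auto
qed

text \<open>By Gauss's lemma one counts the doubles \<open>2 * x\<close> with
  \<open>x <= h = (p - 1) / 2\<close> that exceed \<open>h\<close>. They are those with
  \<open>x > h div 2\<close>, and the parity of \<open>h - h div 2\<close> depends only on
  \<open>p\<close> modulo 8.\<close>

lemma Legendre_two:
  fixes p :: nat
  assumes "prime p" "p > 2"
  shows "Legendre 2 p = (if p mod 8 = 1 \<or> p mod 8 = 7 then 1 else -1)"
proof -
  have op: "odd p" using assms prime_odd_nat by auto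
  interpret GAUSS p 2
    by unfold_locales (use assms op in \<open>auto simp: cong_0_iff zdvd_not_zless\<close>)
  define h where "h = (int p - 1) div 2"
  have p: "int p = 2 * h + 1" unfolding h_def using op by presburger
  have "C = (\<lambda>x. 2 * x) ` {0<..h}"
    unfolding C_def B_def A_def image_image h_def[symmetric] using p
    by (intro image_cong) auto
  then have "E = (\<lambda>x. 2 * x) ` {h div 2<..h}"
    unfolding E_def h_def[symmetric] using p assms(2) by auto
  then have "card E = nat (h - h div 2)"
    by (simp add: card_image inj_on_def)
  moreover have "even (nat (h - h div 2)) \<longleftrightarrow> int p mod 8 = 1 \<or> int p mod 8 = 7"
  proof -
    have "even (nat (h - h div 2)) \<longleftrightarrow> even (h - h div 2)"
      using p assms(2) by (simp add: even_nat_iff)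
    moreover have "even (h - h div 2) \<longleftrightarrow> h mod 4 = 0 \<or> h mod 4 = 3" by presburger
    moreover have "int p mod 8 = 2 * (h mod 4) + 1"
    proof -
      have "int p = (2 * (h mod 4) + 1) + 8 * (h div 4)"
        using p div_mult_mod_eq[of h 4] by linarith
      then have "int p mod 8 = (2 * (h mod 4) + 1) mod 8" by (simp only: mod_mult_self2)
      then show ?thesis by (simp add: mod_pos_pos_trivial)
    qed
    ultimately show ?thesis by auto
  qed
  moreover have "int p mod 8 = int (p mod 8)" by (simp add: zmod_int)
  ultimately show ?thesis using gauss_lemma by auto
qed

text \<open>In the last conjunct \<^term>\<open>f (- 7)\<close> is \<^term>\<open>sgn D * Legendre D 7\<close>, written so that it is
  multiplicative in \<^term>\<open>D\<close> without reference to signs.\<close>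

definition kronecker_character :: "int \<Rightarrow> (int \<Rightarrow> int) \<Rightarrow> bool" where
  "kronecker_character D f \<longleftrightarrow>
     (\<forall>a b. f (a * b) = f a * f b) \<and>
     (\<forall>a b. [a = b] (mod 8 * D) \<longrightarrow> f a = f b) \<and>
     (\<forall>a. coprime a (2 * D) \<longrightarrow> f a \<in> {-1, 1}) \<and>
     (\<forall>a. \<not> coprime a (2 * D) \<longrightarrow> f a = 0) \<and>
     (\<forall>q::nat. prime q \<longrightarrow> q > 2 \<longrightarrow> \<not> int q dvd D \<longrightarrow> f q = Legendre D q) \<and>
     (\<not> 7 dvd D \<longrightarrow> f (-7) = Legendre \<bar>D\<bar> 7)"

text \<open>Every clause of the definition is multiplicative in the discriminant, so existence
  reduces to the discriminants -1, 2 and odd primes.\<close>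

lemma kronecker_character_mult:
  assumes f: "kronecker_character D f" and g: "kronecker_character D' g"
  shows "kronecker_character (D * D') (\<lambda>a. f a * g a)"
  unfolding kronecker_character_def
proof (intro conjI allI impI)
  fix a b
  show "f (a * b) * g (a * b) = f a * g a * (f b * g b)"
    using f g unfolding kronecker_character_def by simp
  have cop: "coprime a (2 * (D * D')) \<longleftrightarrow> coprime a (2 * D) \<and> coprime a (2 * D')"
    by auto
  show "f a * g a \<in> {-1, 1}" if "coprime a (2 * (D * D'))"
  proof -
    have "f a \<in> {-1, 1}" "g a \<in> {-1, 1}"
      using that f g unfolding cop kronecker_character_def by blast+
    then show ?thesis by auto
  qed
  show "f a * g a = 0" if "\<not> coprime a (2 * (D * D'))"
  proof -
    have "f a = 0 \<or> g a = 0" using that f g unfolding cop kronecker_character_def by blast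
    then show ?thesis by auto
  qed
  assume "[a = b] (mod 8 * (D * D'))"
  then have "[a = b] (mod 8 * D)" "[a = b] (mod 8 * D')"
    by (rule cong_dvd_modulus; simp)+
  then have "f a = f b" "g a = g b"
    using f g unfolding kronecker_character_def by blast+
  then show "f a * g a = f b * g b" by simp
next
  fix q :: nat assume q: "prime q" "q > 2" "\<not> int q dvd D * D'"
  then have "\<not> int q dvd D" "\<not> int q dvd D'" by auto
  then show "f q * g q = Legendre (D * D') q"
    using f g q unfolding kronecker_character_def by (simp add: Legendre_mult)
next
  assume 7: "\<not> 7 dvd D * D'"
  have p7: "prime (7 :: nat)" by simp
  have "\<not> 7 dvd D" "\<not> 7 dvd D'" using 7 by auto
  then show "f (-7) * g (-7) = Legendre \<bar>D * D'\<bar> 7"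
    using f g Legendre_mult[OF p7, of "\<bar>D\<bar>" "\<bar>D'\<bar>"] unfolding kronecker_character_def
    by (simp add: abs_mult)
qed

section \<open>Characters for 1, -1, 2 and the odd primes\<close>

lemma QuadRes_1: "QuadRes m 1"
  unfolding QuadRes_def by (rule exI[of _ 1]) simp

lemma Legendre_1: "prime (q :: nat) \<Longrightarrow> Legendre 1 q = 1"
  using QuadRes_1 by (auto simp: Legendre_def cong_0_iff)

lemma mod_8_odd:
  fixes a :: int
  assumes "odd a"
  shows "a mod 8 \<in> {1, 3, 5, 7}"
  using assms by (simp, presburger)

lemma mod_4_odd:
  fixes a :: int
  assumes "odd a"
  shows "a mod 4 \<in> {1, 3}"
  using assms by (simp, presburger)

lemma cong_8_parity:
  fixes a b :: int
  assumes "[a = b] (mod 8)"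
  shows "even a = even b" "a mod 4 = b mod 4"
  using cong_dvd_modulus[OF assms, of 2] cong_dvd_modulus[OF assms, of 4]
  by (simp_all add: cong_def even_iff_mod_2_eq_zero)

lemma kronecker_character_one: "kronecker_character 1 (\<lambda>a. if even a then 0 else 1)"
proof -
  have p7: "prime (7 :: nat)" by simp
  have "Legendre 1 7 = 1" using Legendre_1[OF p7] by simp
  moreover have "even a = even b" if "[a = b] (mod 8)" for a b :: int
    using that by (rule cong_8_parity)
  moreover have "odd q" if "prime q" "q > 2" for q :: nat using that prime_odd_nat by auto
  ultimately show ?thesis
    unfolding kronecker_character_def by (auto simp: Legendre_1)
qed

lemma kronecker_character_minus_one:
  "kronecker_character (-1) (\<lambda>a. if even a then 0 else if a mod 4 = 1 then 1 else -1)"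
  (is "kronecker_character _ ?f")
proof -
  have p7: "prime (7 :: nat)" by simp
  have "Legendre 1 7 = 1" using Legendre_1[OF p7] by simp
  moreover have "even a = even b \<and> (a mod 4 = 1) = (b mod 4 = 1)" if "[a = b] (mod 8)" for a b :: int
    using cong_8_parity[OF that] by simp
  moreover have "odd q" if "prime q" "q > 2" for q :: nat using that prime_odd_nat by auto
  moreover have "?f (a * b) = ?f a * ?f b" for a b
  proof (cases "even a \<or> even b")
    case False
    then have "a mod 4 \<in> {1, 3}" "b mod 4 \<in> {1, 3}" using mod_4_odd by auto
    moreover have "(a * b) mod 4 = (a mod 4 * (b mod 4)) mod 4" by (rule mod_mult_eq[symmetric])
    moreover have "odd (a * b)" using False by simp
    ultimately show ?thesis using False by (elim insertE emptyE) simp_all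
  qed auto
  moreover have "int q mod 4 = 1 \<longleftrightarrow> q mod 4 = 1" for q :: nat by presburger
  ultimately show ?thesis
    unfolding kronecker_character_def
    by (auto simp: Legendre_minus_one)
qed

lemma kronecker_character_two:
  "kronecker_character 2 (\<lambda>a. if even a then 0 else if a mod 8 = 1 \<or> a mod 8 = 7 then 1 else -1)"
  (is "kronecker_character _ ?f")
proof -
  have p7: "prime (7 :: nat)" by simp
  have "Legendre 2 7 = 1" using Legendre_two[OF p7] by simp
  moreover have "even a = even b \<and> a mod 8 = b mod 8" if "[a = b] (mod 16)" for a b :: int
    using cong_dvd_modulus[OF that, of 8] cong_8_parity[of a b] by (simp add: cong_def)
  moreover have "odd q" if "prime q" "q > 2" for q :: nat using that prime_odd_nat by auto
  moreover have "?f (a * b) = ?f a * ?f b" for a b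
  proof (cases "even a \<or> even b")
    case False
    then have "a mod 8 \<in> {1, 3, 5, 7}" "b mod 8 \<in> {1, 3, 5, 7}" using mod_8_odd by auto
    moreover have "(a * b) mod 8 = (a mod 8 * (b mod 8)) mod 8" by (rule mod_mult_eq[symmetric])
    moreover have "odd (a * b)" using False by simp
    ultimately show ?thesis using False by (elim insertE emptyE) simp_all
  qed auto
  moreover have "int q mod 8 = r \<longleftrightarrow> int (q mod 8) = r" for q :: nat and r by (simp add: zmod_int)
  moreover have "coprime a 4 \<longleftrightarrow> odd a" for a :: int
    using coprime_power_right_iff[of a 2 2] by simp
  ultimately show ?thesis
    unfolding kronecker_character_def by (auto simp: Legendre_two)
qed

text \<open>For \<open>p\<close> congruent to 3 modulo 4 the twist by the character modulo 4
  supplies exactly the sign in quadratic reciprocity, so that the value at a prime \<open>q\<close>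
  is \<open>Legendre p q\<close>.\<close>

lemma kronecker_character_odd_prime:
  fixes p :: nat
  assumes p: "prime p" "p > 2"
  shows "kronecker_character p
    (\<lambda>a. if even a then 0 else (if p mod 4 = 3 \<and> a mod 4 = 3 then -1 else 1) * Legendre a p)"
  (is "kronecker_character _ ?f")
proof -
  have op: "odd p" using p prime_odd_nat by auto
  have cong: "even a = even b \<and> a mod 4 = b mod 4 \<and> Legendre a p = Legendre b p"
    if "[a = b] (mod 8 * int p)" for a b :: int
  proof -
    have "[a = b] (mod 8)" "[a = b] (mod int p)" using that by (rule cong_dvd_modulus; simp)+
    moreover from this have "Legendre a p = Legendre b p" by (intro Legendre_cong)
    ultimately show ?thesis using cong_8_parity[of a b] by blast
  qed
  have mult: "?f (a * b) = ?f a * ?f b" for a b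
  proof (cases "even a \<or> even b")
    case False
    then have "a mod 4 \<in> {1, 3}" "b mod 4 \<in> {1, 3}" using mod_4_odd by auto
    moreover have "(a * b) mod 4 = (a mod 4 * (b mod 4)) mod 4" by (rule mod_mult_eq[symmetric])
    moreover have "odd (a * b)" using False by simp
    ultimately show ?thesis using False by (elim insertE emptyE) (simp_all add: Legendre_mult[OF p])
  qed auto
  have rec: "(if p mod 4 = 3 \<and> q mod 4 = 3 then -1 else 1) * Legendre q p = Legendre p q"
    if q: "prime q" "q > 2" "p \<noteq> q" for q :: nat
  proof -
    have "odd q" using q prime_odd_nat by auto
    then have "odd ((p - 1) div 2 * ((q - 1) div 2)) \<longleftrightarrow> p mod 4 = 3 \<and> q mod 4 = 3"
      using op unfolding even_mult_iff by presburger
    then have "Legendre p q * Legendre q p = (if p mod 4 = 3 \<and> q mod 4 = 3 then -1 else 1)"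
      using Quadratic_Reciprocity[OF p q] by (auto simp: minus_one_power_iff)
    moreover have "\<not> int q dvd int p" "\<not> int p dvd int q"
      using p q by (auto dest: primes_dvd_imp_eq)
    ultimately show ?thesis
      using Legendre_values[of p q] Legendre_values[of q p] by (auto split: if_splits)
  qed
  have cop: "coprime a (2 * int p) \<longleftrightarrow> odd a \<and> \<not> int p dvd a" for a :: int
  proof -
    have "coprime (int p) a \<longleftrightarrow> \<not> int p dvd a"
    proof
      assume "coprime (int p) a"
      then show "\<not> int p dvd a" using p by (auto simp: coprime_absorb_left)
    next
      assume "\<not> int p dvd a"
      then show "coprime (int p) a" using p(1) by (intro prime_imp_coprime) auto
    qed
    then show ?thesis using coprime_commute[of a "int p"] by simp
  qed
  \<comment> \<open>Since -7 is 1 modulo 4, the twist is trivial there; the sign of reciprocity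
    between \<open>p\<close> and 7 comes from \<open>Legendre (-1) p\<close> instead.\<close>
  have seven: "?f (-7) = Legendre \<bar>int p\<bar> 7" if "\<not> 7 dvd int p"
  proof -
    have p7: "prime (7 :: nat)" by simp
    have "p \<noteq> 7" using that by auto
    then have "(if p mod 4 = 3 then -1 else 1) * Legendre 7 p = Legendre p 7"
      using rec[OF p7] by simp
    moreover have "Legendre (-7) p = Legendre (-1) p * Legendre 7 p"
      using Legendre_mult[OF p, of "-1" 7] by simp
    moreover have "p mod 4 = 1 \<longleftrightarrow> p mod 4 \<noteq> 3" using op by presburger
    ultimately show ?thesis by (auto simp: Legendre_minus_one[OF p] split: if_splits)
  qed
  have "int q mod 4 = 3 \<longleftrightarrow> q mod 4 = 3" for q :: nat by presburger
  moreover have "odd q" if "prime q" "q > 2" for q :: nat using that prime_odd_nat by auto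
  moreover have "p \<noteq> q" if "\<not> int q dvd int p" for q using that by auto
  ultimately have prim: "?f (int q) = Legendre p q" if "prime q" "q > 2" "\<not> int q dvd int p" for q :: nat
    using rec[of q] that by simp
  show ?thesis
    unfolding kronecker_character_def
  proof (intro conjI allI impI mult prim seven)
    fix a b :: int
    show "?f a = ?f b" if "[a = b] (mod 8 * int p)" using cong[OF that] by simp
    show "?f a \<in> {-1, 1}" if "coprime a (2 * int p)"
    proof -
      have "odd a" "\<not> int p dvd a" using that cop by blast+
      then show ?thesis using Legendre_values[of a p] Legendre_eq_0_iff[of a p] by auto
    qed
    show "?f a = 0" if "\<not> coprime a (2 * int p)"
    proof -
      have "even a \<or> int p dvd a" using that cop by blast
      then show ?thesis using Legendre_eq_0_iff[of a p] by auto
    qed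
  qed auto
qed

lemma kronecker_character_exists:
  assumes "M > 0"
  shows "\<exists>f. kronecker_character (int M) f"
  using assms
proof (induction M rule: less_induct)
  case (less M)
  show ?case
  proof (cases "M = 1")
    case True then show ?thesis using kronecker_character_one by auto
  next
    case False
    then obtain p where p: "prime p" "p dvd M" using prime_factor_nat by blast
    then obtain m where m: "M = p * m" by blast
    then have "m < M" "m > 0" using less.prems prime_gt_1_nat[OF p(1)] by auto
    then obtain g where g: "kronecker_character (int m) g" using less.IH by blast
    obtain h where h: "kronecker_character (int p) h"
    proof (cases "p = 2")
      case True then show ?thesis using that kronecker_character_two by auto
    next
      case False
      then show ?thesis using that kronecker_character_odd_prime[OF p(1)] prime_ge_2_nat[OF p(1)] by force
    qed
    show ?thesis using kronecker_character_mult[OF h g] m by auto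
  qed
qed

lemma kronecker_character_neg_exists:
  assumes "M > 0"
  shows "\<exists>f. kronecker_character (- int M) f"
  using kronecker_character_mult[OF kronecker_character_minus_one]
    kronecker_character_exists[OF assms] by fastforce

section \<open>Ternary forms of determinant 7\<close>

text \<open>The form of the symmetric matrix with diagonal \<open>a\<close>, \<open>b\<close>,
  \<open>c\<close>; the off-diagonal entries \<open>p\<close>, \<open>q\<close>, \<open>r\<close>
  belong to the products \<open>y z\<close>, \<open>x z\<close>, \<open>x y\<close>.\<close>

definition tern :: "int \<Rightarrow> int \<Rightarrow> int \<Rightarrow> int \<Rightarrow> int \<Rightarrow> int \<Rightarrow> int \<Rightarrow> int \<Rightarrow> int \<Rightarrow> int" where
  "tern a b c p q r x y z = a * x\<^sup>2 + b * y\<^sup>2 + c * z\<^sup>2 + 2 * p * y * z + 2 * q * x * z + 2 * r * x * y"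

text \<open>The last conjunct says that modulo 7 the form is anisotropic up to its radical; it separates
  the two genera of determinant 7.\<close>

definition admissible :: "int \<Rightarrow> int \<Rightarrow> int \<Rightarrow> int \<Rightarrow> int \<Rightarrow> int \<Rightarrow> int \<Rightarrow> bool" where
  "admissible m a b c p q r \<longleftrightarrow> a > 0 \<and> a * b - r\<^sup>2 > 0 \<and>
     a * b * c + 2 * p * q * r - a * p\<^sup>2 - b * q\<^sup>2 - c * r\<^sup>2 = 7 \<and>
     (\<exists>x y z. tern a b c p q r x y z = m) \<and>
     (\<forall>x y z. 7 dvd tern a b c p q r x y z \<longrightarrow>
        7 dvd a * x + r * y + q * z \<and> 7 dvd r * x + b * y + p * z \<and> 7 dvd q * x + p * y + c * z)"

section \<open>Invariance under unimodular substitutions\<close>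

lemma admissible_swap_xy:
  assumes "admissible m a b c p q r" shows "admissible m b a c q p r"
proof -
  have "b > 0"
  proof -
    have "a * b > 0" using assms zero_le_power2[of r] unfolding admissible_def by linarith
    then show ?thesis using assms unfolding admissible_def by (simp add: zero_less_mult_iff)
  qed
  moreover have *: "tern b a c q p r x y z = tern a b c p q r y x z" for x y z
    by (simp add: tern_def algebra_simps)
  moreover have "\<exists>x y z. tern a b c p q r y x z = m" using assms unfolding admissible_def by blast
  moreover have "7 dvd b * x + r * y + p * z \<and> 7 dvd r * x + a * y + q * z \<and> 7 dvd p * x + q * y + c * z"
    if "7 dvd tern a b c p q r y x z" for x y z
  proof -
    have "7 dvd a * y + r * x + q * z \<and> 7 dvd r * y + b * x + p * z \<and> 7 dvd q * y + p * x + c * z"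
      using assms that unfolding admissible_def by blast
    then show ?thesis by (simp add: add_ac)
  qed
  moreover have "b * a - r\<^sup>2 > 0" "b * a * c + 2 * q * p * r - b * q\<^sup>2 - a * p\<^sup>2 - c * r\<^sup>2 = 7"
    using assms unfolding admissible_def by (simp_all add: algebra_simps)
  ultimately show ?thesis
    unfolding admissible_def * by blast
qed

lemma admissible_swap_yz:
  assumes "admissible m a b c p q r" shows "admissible m a c b p r q"
proof -
  \<comment> \<open>In this identity between 2 by 2 minors the last bracket is the determinant, so
    the product of the two leading minors is positive.\<close>
  have "(a * b - r\<^sup>2) * (a * c - q\<^sup>2) = (a * p - q * r)\<^sup>2
     + a * (a * b * c + 2 * p * q * r - a * p\<^sup>2 - b * q\<^sup>2 - c * r\<^sup>2)"
    by (simp add: algebra_simps power2_eq_square)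
  also have "\<dots> = (a * p - q * r)\<^sup>2 + a * 7" using assms unfolding admissible_def by simp
  also have "\<dots> > 0" using assms zero_le_power2[of "a * p - q * r"] unfolding admissible_def by linarith
  finally have "a * c - q\<^sup>2 > 0" using assms unfolding admissible_def by (simp add: zero_less_mult_iff)
  moreover have *: "tern a c b p r q x y z = tern a b c p q r x z y" for x y z
    by (simp add: tern_def algebra_simps)
  moreover have "\<exists>x y z. tern a b c p q r x z y = m" using assms unfolding admissible_def by blast
  moreover have "7 dvd a * x + q * y + r * z \<and> 7 dvd q * x + c * y + p * z \<and> 7 dvd r * x + p * y + b * z"
    if "7 dvd tern a b c p q r x z y" for x y z
  proof -
    have "7 dvd a * x + r * z + q * y \<and> 7 dvd r * x + b * z + p * y \<and> 7 dvd q * x + p * z + c * y"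
      using assms that unfolding admissible_def by blast
    then show ?thesis by (simp add: add_ac)
  qed
  moreover have "a > 0" "a * c * b + 2 * p * r * q - a * p\<^sup>2 - c * r\<^sup>2 - b * q\<^sup>2 = 7"
    using assms unfolding admissible_def by (simp_all add: algebra_simps)
  ultimately show ?thesis
    unfolding admissible_def * by blast
qed

lemma admissible_rotate: "admissible m a b c p q r \<Longrightarrow> admissible m b c a q r p"
  by (rule admissible_swap_yz[OF admissible_swap_xy])

text \<open>The new entries are those of the form after replacing \<open>x\<close> by
  \<open>x + k * y\<close>, a substitution of determinant 1. The linear forms in the condition
  modulo 7 change by the same shear.\<close>

lemma admissible_shear:
  assumes "admissible m a b c p q r"
  shows "admissible m a (b + 2 * k * r + k\<^sup>2 * a) c (p + k * q) q (r + k * a)"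
proof -
  have *: "tern a (b + 2 * k * r + k\<^sup>2 * a) c (p + k * q) q (r + k * a) x y z = tern a b c p q r (x + k * y) y z"
    for x y z by (simp add: tern_def algebra_simps power2_eq_square)
  have "\<exists>x y z. tern a b c p q r (x + k * y) y z = m"
  proof -
    obtain x y z where "tern a b c p q r x y z = m" using assms unfolding admissible_def by blast
    then have "tern a b c p q r ((x - k * y) + k * y) y z = m" by simp
    then show ?thesis by blast
  qed
  moreover have "a * (b + 2 * k * r + k\<^sup>2 * a) - (r + k * a)\<^sup>2 = a * b - r\<^sup>2"
    by (simp add: algebra_simps power2_eq_square)
  moreover have "a * (b + 2 * k * r + k\<^sup>2 * a) * c + 2 * (p + k * q) * q * (r + k * a) - a * (p + k * q)\<^sup>2
      - (b + 2 * k * r + k\<^sup>2 * a) * q\<^sup>2 - c * (r + k * a)\<^sup>2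
     = a * b * c + 2 * p * q * r - a * p\<^sup>2 - b * q\<^sup>2 - c * r\<^sup>2"
    by (simp add: algebra_simps power2_eq_square)
  moreover have "7 dvd a * x + (r + k * a) * y + q * z \<and>
      7 dvd (r + k * a) * x + (b + 2 * k * r + k\<^sup>2 * a) * y + (p + k * q) * z \<and>
      7 dvd q * x + (p + k * q) * y + c * z"
    if "7 dvd tern a b c p q r (x + k * y) y z" for x y z
  proof -
    have d: "7 dvd a * (x + k * y) + r * y + q * z" "7 dvd r * (x + k * y) + b * y + p * z"
      "7 dvd q * (x + k * y) + p * y + c * z"
      using assms that unfolding admissible_def by blast+
    have "7 dvd (r * (x + k * y) + b * y + p * z) + k * (a * (x + k * y) + r * y + q * z)"
      by (rule dvd_add[OF d(2) dvd_mult[OF d(1)]])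
    moreover have "a * x + (r + k * a) * y + q * z = a * (x + k * y) + r * y + q * z"
      "(r + k * a) * x + (b + 2 * k * r + k\<^sup>2 * a) * y + (p + k * q) * z
        = (r * (x + k * y) + b * y + p * z) + k * (a * (x + k * y) + r * y + q * z)"
      "q * x + (p + k * q) * y + c * z = q * (x + k * y) + p * y + c * z"
      by (simp_all add: algebra_simps power2_eq_square)
    ultimately show ?thesis using d by simp
  qed
  ultimately show ?thesis
    using assms unfolding admissible_def * by presburger
qed

section \<open>Reduction and the classes of determinant 7\<close>

lemma nearest_multiple:
  fixes a r :: int
  assumes "a > 0"
  shows "\<exists>k. 2 * \<bar>r + k * a\<bar> \<le> a"
proof -
  define k where "k = - ((2 * r + a) div (2 * a))"
  have "2 * r + a = (2 * a) * ((2 * r + a) div (2 * a)) + (2 * r + a) mod (2 * a)" by simp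
  then have "2 * (r + k * a) = (2 * r + a) mod (2 * a) - a" unfolding k_def by (simp add: algebra_simps)
  moreover have "0 \<le> (2 * r + a) mod (2 * a)" "(2 * r + a) mod (2 * a) < 2 * a" using assms by simp_all
  ultimately have "2 * \<bar>r + k * a\<bar> \<le> a" by linarith
  then show ?thesis by blast
qed

text \<open>First \<open>a\<close> and then the minor \<open>a * b - r\<^sup>2\<close> is chosen
  minimal; minimality against the swapped forms gives the last two inequalities. Three shears
  preserving both minima make \<open>r\<close>, the mixed minor \<open>a * p - q * r\<close> and
  \<open>q\<close> small, in this order.\<close>

lemma admissible_reduced:
  assumes "admissible m a0 b0 c0 p0 q0 r0"
  obtains a b c p q r where "admissible m a b c p q r"
    "2 * \<bar>r\<bar> \<le> a" "2 * \<bar>q\<bar> \<le> a" "2 * \<bar>a * p - q * r\<bar> \<le> a * b - r\<^sup>2"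
    "a \<le> b" "a * b - r\<^sup>2 \<le> a * c - q\<^sup>2"
proof -
  have "\<exists>n. \<exists>a b c p q r. admissible m a b c p q r \<and> nat a = n" using assms by blast
  then obtain n where n: "\<exists>a b c p q r. admissible m a b c p q r \<and> nat a = n"
    and nmin: "\<And>a b c p q r. admissible m a b c p q r \<Longrightarrow> n \<le> nat a"
    using exists_least_iff[of "\<lambda>n. \<exists>a b c p q r. admissible m a b c p q r \<and> nat a = n"]
    by (metis not_le_imp_less)
  define a where "a = int n"
  have apos: "a > 0" using n unfolding a_def admissible_def by auto
  have amin: "a \<le> a'" if "admissible m a' b' c' p' q' r'" for a' b' c' p' q' r'
  proof -
    have "a' > 0" using that unfolding admissible_def by blast
    then show ?thesis using nmin[OF that] unfolding a_def by linarith
  qed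
  have "\<exists>l. \<exists>b c p q r. admissible m a b c p q r \<and> nat (a * b - r\<^sup>2) = l"
    using n unfolding a_def admissible_def by force
  then obtain l where l: "\<exists>b c p q r. admissible m a b c p q r \<and> nat (a * b - r\<^sup>2) = l"
    and lmin: "\<And>b c p q r. admissible m a b c p q r \<Longrightarrow> l \<le> nat (a * b - r\<^sup>2)"
    using exists_least_iff[of "\<lambda>l. \<exists>b c p q r. admissible m a b c p q r \<and> nat (a * b - r\<^sup>2) = l"]
    by (metis not_le_imp_less)
  obtain b1 c1 p1 q1 r1 where 1: "admissible m a b1 c1 p1 q1 r1" "nat (a * b1 - r1\<^sup>2) = l" using l by blast
  define C where "C = int l"
  have C1: "a * b1 - r1\<^sup>2 = C" "C > 0" using 1 unfolding C_def admissible_def by auto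
  obtain k where k: "2 * \<bar>r1 + k * a\<bar> \<le> a" using nearest_multiple[OF apos] by blast
  define b2 p2 r2 where "b2 = b1 + 2 * k * r1 + k\<^sup>2 * a" and "p2 = p1 + k * q1" and "r2 = r1 + k * a"
  have 2: "admissible m a b2 c1 p2 q1 r2" unfolding b2_def p2_def r2_def by (rule admissible_shear[OF 1(1)])
  have C2: "a * b2 - r2\<^sup>2 = C"
    unfolding b2_def r2_def C1(1)[symmetric] by (simp add: algebra_simps power2_eq_square)
  \<comment> \<open>Adding \<open>k'\<close> times the second variable's row to the third changes
    the mixed minor by \<open>k' * C\<close> and leaves \<open>a\<close>, \<open>b2\<close>,
    \<open>r2\<close> alone.\<close>
  obtain k' where k': "2 * \<bar>(a * p2 - q1 * r2) + k' * C\<bar> \<le> C" using nearest_multiple[OF C1(2)] by blast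
  define c3 p3 q3 where "c3 = c1 + 2 * k' * p2 + k'\<^sup>2 * b2" and "p3 = p2 + k' * b2" and "q3 = q1 + k' * r2"
  have 3: "admissible m a b2 c3 p3 q3 r2"
    using admissible_rotate[OF admissible_rotate[OF admissible_shear[OF admissible_rotate[OF 2], of k']]]
    unfolding c3_def p3_def q3_def .
  have C3: "2 * \<bar>a * p3 - q3 * r2\<bar> \<le> C"
    using k' unfolding p3_def q3_def C2[symmetric] by (simp add: algebra_simps power2_eq_square)
  \<comment> \<open>The last shear makes \<open>q\<close> small without altering the mixed minor
    (see \<open>C4\<close>).\<close>
  obtain k'' where k'': "2 * \<bar>q3 + k'' * a\<bar> \<le> a" using nearest_multiple[OF apos] by blast
  define c4 p4 q4 where "c4 = c3 + 2 * k'' * q3 + k''\<^sup>2 * a" and "p4 = p3 + k'' * r2" and "q4 = q3 + k'' * a"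
  have 4: "admissible m a b2 c4 p4 q4 r2"
    using admissible_swap_yz[OF admissible_shear[OF admissible_swap_yz[OF 3], of k'']]
    unfolding c4_def p4_def q4_def .
  have C4: "a * p4 - q4 * r2 = a * p3 - q3 * r2" unfolding p4_def q4_def by (simp add: algebra_simps)
  show thesis
  proof (rule that[OF 4])
    show "2 * \<bar>r2\<bar> \<le> a" "2 * \<bar>q4\<bar> \<le> a" using k k'' unfolding r2_def q4_def by auto
    show "2 * \<bar>a * p4 - q4 * r2\<bar> \<le> a * b2 - r2\<^sup>2" using C3 C4 C2 by simp
    show "a \<le> b2" by (rule amin[OF admissible_swap_xy[OF 4]])
    have "l \<le> nat (a * c4 - q4\<^sup>2)" by (rule lmin[OF admissible_swap_yz[OF 4]])
    then show "a * b2 - r2\<^sup>2 \<le> a * c4 - q4\<^sup>2" using C2 C1(2) unfolding C_def by linarith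
  qed
qed

text \<open>The identity \<open>C * C' = P\<^sup>2 + 7 * a\<close> and the reduction inequalities
  give \<open>3 * C\<^sup>2 <= 28 * a\<close> and \<open>3 * a\<^sup>2 <= 4 * C\<close>, hence
  \<open>a <= 2\<close>. The few remaining matrices with \<open>a = 1\<close> give the two stated
  forms, and \<open>a = 2\<close> violates the condition modulo 7.\<close>

lemma admissible_represents:
  assumes "admissible m a0 b0 c0 p0 q0 r0"
  shows "(\<exists>x y z. m = x\<^sup>2 + y\<^sup>2 + 7 * z\<^sup>2) \<or> (\<exists>x y z. m = x\<^sup>2 + 2 * (y\<^sup>2 + y * z + 2 * z\<^sup>2))"
proof -
  obtain a b c p q r where adm: "admissible m a b c p q r"
    and red: "2 * \<bar>r\<bar> \<le> a" "2 * \<bar>q\<bar> \<le> a" "2 * \<bar>a * p - q * r\<bar> \<le> a * b - r\<^sup>2"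
      "a \<le> b" "a * b - r\<^sup>2 \<le> a * c - q\<^sup>2"
    using admissible_reduced[OF assms] by blast
  define C P C' where "C = a * b - r\<^sup>2" and "P = a * p - q * r" and "C' = a * c - q\<^sup>2"
  have pos: "a > 0" "C > 0"
    and det: "a * b * c + 2 * p * q * r - a * p\<^sup>2 - b * q\<^sup>2 - c * r\<^sup>2 = 7"
    using adm unfolding admissible_def C_def by blast+
  have "C * C' = P\<^sup>2 + a * (a * b * c + 2 * p * q * r - a * p\<^sup>2 - b * q\<^sup>2 - c * r\<^sup>2)"
    unfolding C_def C'_def P_def by (simp add: algebra_simps power2_eq_square)
  then have CC: "C * C' = P\<^sup>2 + 7 * a" using det by simp
  have le: "C \<le> C'" "2 * \<bar>P\<bar> \<le> C" using red unfolding C_def C'_def P_def by auto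
  have "(2 * \<bar>P\<bar>)\<^sup>2 \<le> C\<^sup>2" using le(2) by (intro power_mono) auto
  moreover have "C\<^sup>2 \<le> C * C'" unfolding power2_eq_square using le(1) pos(2) by (intro mult_left_mono) auto
  ultimately have C28: "3 * C\<^sup>2 \<le> 28 * a" using CC by (simp add: power_mult_distrib)
  have "(2 * \<bar>r\<bar>)\<^sup>2 \<le> a\<^sup>2" using red(1) by (intro power_mono) auto
  moreover have "a\<^sup>2 \<le> a * b" unfolding power2_eq_square using red(4) pos(1) by (intro mult_left_mono) auto
  ultimately have aC: "3 * a\<^sup>2 \<le> 4 * C" unfolding C_def by (simp add: power_mult_distrib)
  have "a \<le> 2"
  proof (rule ccontr)
    assume "\<not> a \<le> 2"
    then have a3: "a \<ge> 3" by simp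
    have "(3 * a\<^sup>2)\<^sup>2 \<le> (4 * C)\<^sup>2" using aC by (intro power_mono) auto
    then have "27 * (a\<^sup>2 * a\<^sup>2) \<le> 448 * a" using C28 by (simp add: power2_eq_square)
    moreover have "a * 27 \<le> a\<^sup>2 * a\<^sup>2"
    proof -
      have "3 * 3 * 3 \<le> a * a * a" using a3 by (intro mult_mono) auto
      then have "a * 27 \<le> a * (a * a * a)" using a3 by (intro mult_left_mono) auto
      then show ?thesis by (simp add: power2_eq_square mult_ac)
    qed
    ultimately show False using a3 by linarith
  qed
  then have "a = 1 \<or> a = 2" using pos by auto
  then show ?thesis
  proof
    assume a: "a = 1"
    then have rq: "r = 0" "q = 0" using red by auto
    have "C < 4"
    proof (rule ccontr)
      assume "\<not> C < 4"
      then have "4 * 4 \<le> C * C" by (intro mult_mono) auto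
      then show False using C28 a by (simp add: power2_eq_square)
    qed
    then have b: "b \<in> {1, 2, 3}" using pos a rq unfolding C_def by auto
    have p: "p \<in> {-1, 0, 1}" and bc: "b * c = p\<^sup>2 + 7" using le(2) CC \<open>C < 4\<close> a rq
      unfolding C_def P_def C'_def by auto
    obtain x y z where xyz: "m = tern a b c p q r x y z" using adm unfolding admissible_def by blast
    \<comment> \<open>From \<open>b * c = p\<^sup>2 + 7\<close> and
      \<open>2 * \<bar>p\<bar> <= b\<close>: for \<open>b = 3\<close> the right side is 7 or 8, not
      divisible by 3, and for \<open>b = 2\<close> it must be even.\<close>
    have "b = 1 \<and> p = 0 \<and> c = 7 \<or> b = 2 \<and> p = 1 \<and> c = 4 \<or> b = 2 \<and> p = -1 \<and> c = 4"
      using b p bc le(2) a rq unfolding C_def P_def by (elim insertE emptyE; simp; presburger?)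
    then show ?thesis
    proof (elim disjE conjE)
      assume "b = 1" "p = 0" "c = 7"
      then show ?thesis using xyz a rq unfolding tern_def by auto
    next
      assume "b = 2" "p = 1" "c = 4"
      then have "m = x\<^sup>2 + 2 * (y\<^sup>2 + y * z + 2 * z\<^sup>2)" using xyz a rq unfolding tern_def by simp
      then show ?thesis by blast
    next
      assume "b = 2" "p = -1" "c = 4"
      then have "m = x\<^sup>2 + 2 * ((-y)\<^sup>2 + (-y) * z + 2 * z\<^sup>2)" using xyz a rq unfolding tern_def by simp
      then show ?thesis by blast
    qed
  next
    assume a: "a = 2"
    then have rq: "r \<in> {-1, 0, 1}" "q \<in> {-1, 0, 1}" using red by auto
    have "C < 5"
    proof (rule ccontr)
      assume "\<not> C < 5"
      then have "5 * 5 \<le> C * C" by (intro mult_mono) auto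
      then show False using C28 a by (simp add: power2_eq_square)
    qed
    moreover have "C \<ge> 3" using aC a by simp
    ultimately have "C = 3 \<or> C = 4" by auto
    moreover have "C \<noteq> 4"
    proof
      assume "C = 4"
      \<comment> \<open>The numbers \<open>P\<^sup>2 + 14\<close> are 14, 15 and 18, none divisible
        by 4.\<close>
      then have "P \<in> {-2, -1, 0, 1, 2}" "4 * C' = P\<^sup>2 + 14" using le(2) CC a by auto
      then show False by (elim insertE emptyE; simp; presburger)
    qed
    ultimately have "C = 3" by simp
    then have "P \<in> {-1, 0, 1}" "3 * C' = P\<^sup>2 + 14" using le(2) CC a by auto
    then have C': "C' = 5" by (elim insertE emptyE; simp; presburger?)
    have "2 * b = r\<^sup>2 + 3" using \<open>C = 3\<close> a unfolding C_def by simp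
    then have "b = 2" using rq(1) by (elim insertE emptyE; simp; presburger?)
    have "2 * c = q\<^sup>2 + 5" using C' a unfolding C'_def by simp
    then have "c = 3" "q = 1 \<or> q = -1" using rq(2) by (elim insertE emptyE; simp; presburger?)+
    \<comment> \<open>the class of determinant 7 with minimum 2 is isotropic modulo its radical at 7\<close>
    have "tern a b c p q r 1 0 q = 7" "a * 1 + r * 0 + q * q = 3"
      using a \<open>c = 3\<close> \<open>q = 1 \<or> q = -1\<close> unfolding tern_def by auto
    moreover have "7 dvd tern a b c p q r 1 0 q \<Longrightarrow> 7 dvd a * 1 + r * 0 + q * q"
      using adm unfolding admissible_def by blast
    ultimately have "(7 :: int) dvd 3" by simp
    then show ?thesis by simp
  qed
qed

section \<open>Integers represented by the genus\<close>

lemma QuadRes_squarefree: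
  fixes a :: nat
  assumes "squarefree a" "\<And>p. prime p \<Longrightarrow> p dvd a \<Longrightarrow> QuadRes (int p) D"
  shows "QuadRes (int a) D"
  using assms
proof (induction a rule: less_induct)
  case (less a)
  have "a > 0" using less.prems(1) by (auto intro!: Nat.gr0I)
  show ?case
  proof (cases "a = 1")
    case True then show ?thesis by (simp add: QuadRes_def)
  next
    case False
    then obtain p where p: "prime p" "p dvd a" using prime_factor_nat by blast
    then obtain m where m: "a = p * m" by blast
    have "m < a" using \<open>a > 0\<close> m prime_gt_1_nat[OF p(1)] by auto
    moreover have "squarefree m" using less.prems(1) m squarefree_multD(2) by blast
    moreover have "QuadRes (int q) D" if "prime q" "q dvd m" for q
      using less.prems(2)[OF that(1)] that(2) m by simp
    ultimately have "QuadRes (int m) D" by (rule less.IH)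
    then obtain v where v: "[v\<^sup>2 = D] (mod int m)" unfolding QuadRes_def by blast
    obtain u where u: "[u\<^sup>2 = D] (mod int p)" using less.prems(2)[OF p] unfolding QuadRes_def by blast
    have "\<not> p dvd m"
    proof
      assume "p dvd m"
      then have "p ^ 2 dvd a" unfolding m by (auto simp: power2_eq_square)
      then show False using less.prems(1) p(1) unfolding squarefree_def by (auto simp: power2_eq_square)
    qed
    then have cop: "coprime (int p) (int m)" using p(1) by (simp add: prime_imp_coprime)
    obtain x where x: "[x = u] (mod int p)" "[x = v] (mod int m)"
      using binary_chinese_remainder_int[OF cop, of u v] by blast
    have "[x\<^sup>2 = D] (mod int p)" "[x\<^sup>2 = D] (mod int m)"
      using cong_trans[OF cong_pow[OF x(1)] u] cong_trans[OF cong_pow[OF x(2)] v] by blast+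
    then have "[x\<^sup>2 = D] (mod int p * int m)" using cop by (rule coprime_cong_mult)
    then show ?thesis unfolding QuadRes_def m by auto
  qed
qed

lemma Legendre_7:
  assumes "M mod 7 \<in> {1, 2, 4}"
  shows "Legendre M 7 = 1"
proof -
  have "\<exists>y. y\<^sup>2 mod 7 = M mod 7"
    using assms exI[of "\<lambda>y. y\<^sup>2 mod 7 = M mod 7" 1] exI[of "\<lambda>y. y\<^sup>2 mod 7 = M mod 7" 3]
      exI[of "\<lambda>y. y\<^sup>2 mod 7 = M mod 7" 2] by auto
  moreover have "\<not> 7 dvd M" using assms by (auto simp: dvd_eq_mod_eq_0)
  ultimately show ?thesis by (auto simp: Legendre_def QuadRes_def cong_def dvd_eq_mod_eq_0)
qed

text \<open>Take \<open>A\<close> in the class of -7 modulo \<open>8 * M\<close> with positive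
  divisor sum, and let \<open>a\<close> be its squarefree part. A prime dividing \<open>a\<close>
  has odd exponent in \<open>A\<close>, so its local factor is nonzero only if the character is 1
  there, that is, if \<open>- M\<close> is a square modulo it.\<close>

lemma auxiliary_number:
  fixes M :: nat
  assumes M: "M > 0" "int M mod 7 \<in> {1, 2, 4}"
  shows "\<exists>a s::nat. a > 0 \<and> [- 7 * int (a * s\<^sup>2) = 49] (mod int M) \<and> QuadRes (int a) (- int M)"
proof -
  obtain f where f: "kronecker_character (- int M) f" using kronecker_character_neg_exists[OF M(1)] by blast
  \<comment> \<open>A positive representative of -7 modulo \<open>8 * M\<close>.\<close>
  define c where "c = 56 * M - 7"
  define g where "g n = f (int n)" for n
  have n7: "\<not> 7 dvd int M" using M(2) by (auto simp: dvd_eq_mod_eq_0)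
  have fcong: "f x = f y" if "[x = y] (mod int (8 * M))" for x y
    using f that unfolding kronecker_character_def by simp
  have c7: "[int c = - 7] (mod int (8 * M))"
  proof -
    have "int c = - 7 + int (8 * M) * 7" unfolding c_def using M(1) by (simp add: of_nat_diff)
    then show ?thesis by (simp add: cong_iff_dvd_diff)
  qed
  have cop8: "coprime x (int (8 * M)) \<longleftrightarrow> coprime x (2 * - int M)" for x
  proof -
    have "coprime x 8 \<longleftrightarrow> coprime x 2" using coprime_power_right_iff[of x 2 3] by simp
    then show ?thesis by (simp del: coprime_right_2_iff_odd)
  qed
  have mult: "g (x * y) = g x * g y" for x y using f unfolding g_def kronecker_character_def by simp
  have one: "g 1 = 1"
  proof -
    have "g 1 \<in> {-1, 1}" using f unfolding g_def kronecker_character_def by simp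
    moreover have "g 1 = g 1 * g 1" using mult[of 1 1] by simp
    ultimately show ?thesis by auto
  qed
  have "\<exists>A>0. [A = c] (mod 8 * M) \<and> (\<Sum>d | d dvd A. g d) > 0"
  proof (rule real_character_progression[OF _ mult _ _ _ one])
    show "8 * M > 0" using M by simp
    show "g a = g b" if "[a = b] (mod 8 * M)" for a b
      unfolding g_def using that cong_int_iff[of a b "8 * M"] by (intro fcong) simp
    show "g a = 1 \<or> g a = - 1" if "coprime a (8 * M)" for a
    proof -
      have "coprime (int a) (2 * - int M)" using that unfolding cop8[symmetric] coprime_int_iff .
      then show ?thesis using f unfolding g_def kronecker_character_def by blast
    qed
    show "g a = 0" if "\<not> coprime a (8 * M)" for a
    proof -
      have "\<not> coprime (int a) (2 * - int M)" using that unfolding cop8[symmetric] coprime_int_iff .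
      then show ?thesis using f unfolding g_def kronecker_character_def by blast
    qed
    have "f (-7) = 1"
      using f n7 Legendre_7[OF M(2)] unfolding kronecker_character_def by simp
    then show "g c = 1" unfolding g_def using fcong[OF c7] by simp
    then have "g c \<noteq> 0" by simp
    then show "coprime c (8 * M)"
      using f unfolding g_def kronecker_character_def coprime_int_iff[symmetric] cop8 by blast
  qed
  then obtain A where A: "A > 0" "[A = c] (mod 8 * M)" "(\<Sum>d | d dvd A. g d) > 0" by blast
  have gA: "g A = 1"
  proof -
    have "[int A = - 7] (mod int (8 * M))" using A(2) c7 cong_int_iff[of A c "8 * M"] cong_trans by blast
    then have "g A = f (-7)" unfolding g_def by (rule fcong)
    then show ?thesis using f n7 Legendre_7[OF M(2)] unfolding kronecker_character_def by simp
  qed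
  have unit: "coprime (int x) (2 * - int M)" if "x dvd A" for x
  proof -
    have "g x \<noteq> 0" using that gA mult by (auto elim!: dvdE)
    then show ?thesis using f unfolding g_def kronecker_character_def by blast
  qed
  define a s where "a = squarefree_part A" and "s = square_part A"
  have As: "A = a * s\<^sup>2" unfolding a_def s_def by (rule squarefree_decompose)
  have sqf: "squarefree a" unfolding a_def by (rule squarefree_squarefree_part)
  have "QuadRes (int p) (- int M)" if p: "prime p" "p dvd a" for p
  proof -
    have pA: "p dvd A" using p(2) As by simp
    have cop: "coprime (int p) (2 * - int M)" using unit[OF pA] .
    have nu: "\<not> is_unit p" using p(1) not_prime_unit by blast
    define k where "k = multiplicity p A"
    obtain b where b: "A = p ^ k * b" "\<not> p dvd b"
      using multiplicity_decompose'[OF _ nu, of A] A(1) unfolding k_def by blast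
    have "odd k"
    proof -
      have "multiplicity p a = 1"
        using sqf p A(1) As by (intro antisym)
         (auto simp: squarefree_factorial_semiring' prime_factors_multiplicity prime_multiplicity_gt_zero_iff Suc_le_eq)
      then have "k = 1 + 2 * multiplicity p s"
        unfolding k_def As using p A(1) As
        by (subst prime_elem_multiplicity_mult_distrib) (auto simp: prime_elem_multiplicity_power_distrib)
      then show ?thesis by simp
    qed
    have "g p \<noteq> -1"
    proof
      assume "g p = -1"
      then have "(\<Sum>i\<le>k. g p ^ i) = 0" using \<open>odd k\<close> by (intro sum_powers_sign(3)) auto
      then have "(\<Sum>d | d dvd A. g d) = 0"
        unfolding b(1) using sum_divisors_prime_power_mult[OF mult one p(1) b(2)] by simp
      then show False using A(3) by simp
    qed
    moreover have "g p \<in> {-1, 1}" using cop f unfolding g_def kronecker_character_def by blast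
    ultimately have "g p = 1" by auto
    moreover have "p > 2"
    proof -
      have "p \<noteq> 2" using cop by auto
      then show ?thesis using prime_ge_2_nat[OF p(1)] by simp
    qed
    moreover have ndvd: "\<not> int p dvd - int M"
    proof
      assume "int p dvd - int M"
      moreover have "coprime (int p) (- int M)" using cop by simp
      ultimately have "is_unit (int p)" using coprime_common_divisor[of "int p" "- int M" "int p"] by simp
      then show False using nu by simp
    qed
    ultimately have "Legendre (- int M) p = 1"
      using f p(1) unfolding g_def kronecker_character_def by auto
    then show ?thesis using Legendre_eq_1_iff[OF ndvd] by blast
  qed
  then have "QuadRes (int a) (- int M)" using QuadRes_squarefree[OF sqf] by blast
  \<comment> \<open>The square part \<open>s\<close> is kept because only the full number
    \<open>A\<close> has a known residue modulo \<open>M\<close>.\<close>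
  moreover have "[- 7 * int A = - 7 * - 7] (mod int M)"
  proof -
    have "[int A = - 7] (mod int (8 * M))" using A(2) c7 cong_int_iff[of A c "8 * M"] cong_trans by blast
    then have "[int A = - 7] (mod int M)" by (rule cong_dvd_modulus) simp
    then show ?thesis by (intro cong_mult cong_refl)
  qed
  moreover have "a > 0" using As A(1) by (auto intro!: Nat.gr0I)
  ultimately show ?thesis unfolding As by auto
qed

text \<open>Modulo 7, \<open>d\<close> is a nonzero square and -1 is not a square, so
  \<open>- d\<close> is a nonsquare and the binary form is anisotropic.\<close>

lemma squares_mod_7:
  fixes u v d :: int
  assumes "7 dvd u\<^sup>2 + d * v\<^sup>2" and "d mod 7 \<in> {1, 2, 4}"
  shows "7 dvd u" "7 dvd v"
proof -
  have sq: "7 dvd x \<and> x\<^sup>2 mod 7 = 0 \<or> x\<^sup>2 mod 7 \<in> {1, 2, 4}" for x :: int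
  proof -
    have "x mod 7 \<in> {0, 1, 2, 3, 4, 5, 6}" by (simp, presburger)
    moreover have "x\<^sup>2 mod 7 = (x mod 7)\<^sup>2 mod 7" by (rule power_mod[symmetric])
    ultimately show ?thesis by (elim insertE emptyE) (simp_all add: dvd_eq_mod_eq_0)
  qed
  have "((u\<^sup>2 mod 7) + (d mod 7) * (v\<^sup>2 mod 7)) mod 7 = (u\<^sup>2 + d * v\<^sup>2) mod 7"
    by (intro mod_add_cong mod_mult_cong) auto
  then have "((u\<^sup>2 mod 7) + (d mod 7) * (v\<^sup>2 mod 7)) mod 7 = 0" using assms(1) by (simp only: dvd_eq_mod_eq_0)
  then have "7 dvd u \<and> 7 dvd v"
    using sq[of u] sq[of v] assms(2) by (elim disjE conjE insertE emptyE) simp_all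
  then show "7 dvd u" "7 dvd v" by blast+
qed

text \<open>The matrix with rows \<open>(a, b, 0)\<close>, \<open>(b, c, 7 k)\<close>,
  \<open>(0, 7 k, 7 M)\<close> has determinant 7 when \<open>a c - b\<^sup>2 = d\<close> and
  \<open>M d = 1 + 7 a k\<^sup>2\<close>. Classification represents \<open>7 * M\<close> by one of
  two forms, and descent by a factor 7 turns them into the two forms claimed for
  \<open>M\<close>.\<close>

lemma genus_representation:
  fixes M :: int
  assumes M: "M > 0" "M mod 7 \<in> {1, 2, 4}"
  shows "(\<exists>x y z. M = 7 * x\<^sup>2 + 7 * y\<^sup>2 + z\<^sup>2) \<or> (\<exists>x p q. M = 7 * x\<^sup>2 + 2 * (p\<^sup>2 + p * q + 2 * q\<^sup>2))"
proof -
  have "nat M > 0" "int (nat M) mod 7 \<in> {1, 2, 4}" using M by auto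
  from auxiliary_number[OF this] obtain a' s :: nat
    where as: "a' > 0" "[- 7 * int (a' * s\<^sup>2) = 49] (mod M)" "QuadRes (int a') (- M)"
    using M(1) by auto
  define a where "a = int a'"
  have "a > 0" using as(1) by (simp add: a_def)
  have "\<not> 7 dvd M" using M(2) by (auto simp: dvd_eq_mod_eq_0)
  then have "coprime 7 M" using prime_imp_coprime[of "7 :: int" M] by simp
  then obtain j where j: "[7 * j = 1] (mod M)" using cong_solve_coprime_int by blast
  \<comment> \<open>With \<open>j\<close> inverse to 7 modulo \<open>M\<close>, this makes
    \<open>- 7 * a * k\<^sup>2\<close> congruent to 1 modulo \<open>M\<close>.\<close>
  define k where "k = int s * j"
  have "[- 7 * int (a' * s\<^sup>2) * j\<^sup>2 = 49 * j\<^sup>2] (mod M)" by (intro cong_mult as(2) cong_refl)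
  moreover have "49 * j\<^sup>2 = (7 * j)\<^sup>2" by (simp add: power_mult_distrib)
  moreover have "[(7 * j)\<^sup>2 = 1\<^sup>2] (mod M)" using j by (rule cong_pow)
  ultimately have "[- 7 * int (a' * s\<^sup>2) * j\<^sup>2 = 1\<^sup>2] (mod M)" using cong_trans by (simp only:) blast
  then have "[- 7 * int (a' * s\<^sup>2) * j\<^sup>2 = 1] (mod M)" by (simp only: one_power2)
  moreover have "- 7 * int (a' * s\<^sup>2) * j\<^sup>2 = - 7 * a * k\<^sup>2"
    by (simp add: a_def k_def power_mult_distrib)
  ultimately have "M dvd - 7 * a * k\<^sup>2 - 1" by (simp only: cong_iff_dvd_diff)
  then have "M dvd - (- 7 * a * k\<^sup>2 - 1)" by (simp only: dvd_minus_iff)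
  then obtain d where d: "1 + 7 * a * k\<^sup>2 = M * d" by (auto elim!: dvdE)
  have "M * d > 0" unfolding d[symmetric] using \<open>a > 0\<close> by (simp add: add_pos_nonneg)
  then have "d > 0" using M(1) by (simp add: zero_less_mult_iff)
  obtain y where "[y\<^sup>2 = - M] (mod a)" using as(3) unfolding QuadRes_def a_def by blast
  then have y: "a dvd y\<^sup>2 + M" by (simp add: cong_iff_dvd_diff)
  \<comment> \<open>As \<open>y\<^sup>2\<close> is \<open>- M\<close> and \<open>M * d\<close> is 1
    modulo \<open>a\<close>, the square of \<open>y * d\<close> is \<open>- d\<close> modulo
    \<open>a\<close>.\<close>
  define b where "b = y * d"
  have "b\<^sup>2 + d = (y\<^sup>2 + M) * d\<^sup>2 + d * (1 - M * d)"
    by (simp add: b_def algebra_simps power2_eq_square)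
  also have "1 - M * d = a * (- 7 * k\<^sup>2)" using d by simp
  finally have "b\<^sup>2 + d = (y\<^sup>2 + M) * d\<^sup>2 + d * (a * (- 7 * k\<^sup>2))" .
  moreover have "a dvd (y\<^sup>2 + M) * d\<^sup>2 + d * (a * (- 7 * k\<^sup>2))"
    by (rule dvd_add[OF dvd_mult2[OF y] dvd_mult[OF dvd_triv_left]])
  ultimately have "a dvd b\<^sup>2 + d" by (simp only:)
  then obtain c where c: "b\<^sup>2 + d = a * c" by (auto elim!: dvdE)
  then have dd: "a * c - b\<^sup>2 = d" by simp
  have d7: "d mod 7 \<in> {1, 2, 4}"
  proof -
    have "(M mod 7) * (d mod 7) mod 7 = (1 + 7 * (a * k\<^sup>2)) mod 7"
      using d by (simp add: mod_mult_eq mult.assoc)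
    then have "(M mod 7) * (d mod 7) mod 7 = 1" by simp
    moreover have "d mod 7 \<in> {0, 1, 2, 3, 4, 5, 6}" by (simp, presburger)
    ultimately show ?thesis using M(2) by (elim insertE emptyE) simp_all
  qed
  have a7: "\<not> 7 dvd a"
  proof
    assume "7 dvd a"
    then have "7 dvd b\<^sup>2 + d * 1\<^sup>2" using c by simp
    from squares_mod_7(2)[OF this d7] show False by simp
  qed
  have "admissible (7 * M) a c (7 * M) (7 * k) 0 b"
    unfolding admissible_def
  proof (intro conjI allI impI)
    show "a > 0" by fact
    show "0 < a * c - b\<^sup>2" using c \<open>d > 0\<close> by simp
    have "a * c * (7 * M) + 2 * (7 * k) * 0 * b - a * (7 * k)\<^sup>2 - c * 0\<^sup>2 - 7 * M * b\<^sup>2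
        = 7 * (M * (a * c - b\<^sup>2)) - 49 * a * k\<^sup>2"
      by (simp add: algebra_simps power2_eq_square)
    also have "a * c - b\<^sup>2 = d" using c by simp
    also have "7 * (M * d) - 49 * a * k\<^sup>2 = 7" using d by simp
    finally show "a * c * (7 * M) + 2 * (7 * k) * 0 * b - a * (7 * k)\<^sup>2 - c * 0\<^sup>2 - 7 * M * b\<^sup>2 = 7" .
    show "\<exists>x y z. tern a c (7 * M) (7 * k) 0 b x y z = 7 * M"
      by (intro exI[of _ 0] exI[of _ 1]) (simp add: tern_def)
  next
    fix x y z :: int
    assume T: "7 dvd tern a c (7 * M) (7 * k) 0 b x y z"
    \<comment> \<open>Completing the square in \<open>x\<close> reduces the form modulo 7 to the
      anisotropic binary form with coefficient \<open>d\<close>.\<close>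
    have "a * tern a c (7 * M) (7 * k) 0 b x y z = (a * x + b * y)\<^sup>2 + (a * c - b\<^sup>2) * y\<^sup>2 + 7 * (a * (M * z\<^sup>2 + 2 * k * y * z))"
      by (simp add: tern_def algebra_simps power2_eq_square)
    moreover have "7 dvd a * tern a c (7 * M) (7 * k) 0 b x y z" using T by simp
    ultimately have "7 dvd (a * x + b * y)\<^sup>2 + d * y\<^sup>2"
      unfolding dd[symmetric] by (simp add: dvd_add_left_iff)
    then have 7: "7 dvd a * x + b * y" "7 dvd y" using squares_mod_7[OF _ d7] by blast+
    then have "7 dvd a * x" by (simp add: dvd_add_left_iff)
    then have "7 dvd x" using a7 prime_dvd_mult_iff[of "7 :: int" a x] by simp
    with 7 show "7 dvd a * x + b * y + 0 * z" "7 dvd b * x + c * y + 7 * k * z" "7 dvd 0 * x + 7 * k * y + 7 * M * z"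
      by simp_all
  qed
  from admissible_represents[OF this] show ?thesis
  proof (elim disjE exE)
    fix x y z assume eq: "7 * M = x\<^sup>2 + y\<^sup>2 + 7 * z\<^sup>2"
    then have "x\<^sup>2 + 1 * y\<^sup>2 = 7 * (M - z\<^sup>2)" by simp
    then have "7 dvd x\<^sup>2 + 1 * y\<^sup>2" by (metis dvd_triv_left)
    from squares_mod_7[OF this] obtain x' y' where "x = 7 * x'" "y = 7 * y'" by (auto elim!: dvdE)
    then have "M = 7 * x'\<^sup>2 + 7 * y'\<^sup>2 + z\<^sup>2" using eq by (simp add: power_mult_distrib)
    then show ?thesis by blast
  next
    fix x y z assume eq: "7 * M = x\<^sup>2 + 2 * (y\<^sup>2 + y * z + 2 * z\<^sup>2)"
    have "(2 * y + z)\<^sup>2 + 2 * x\<^sup>2 = 2 * (x\<^sup>2 + 2 * (y\<^sup>2 + y * z + 2 * z\<^sup>2)) - 7 * z\<^sup>2"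
      by (simp add: algebra_simps power2_eq_square)
    also have "\<dots> = 7 * (2 * M - z\<^sup>2)" using eq by simp
    finally have "7 dvd (2 * y + z)\<^sup>2 + 2 * x\<^sup>2" by (metis dvd_triv_left)
    from squares_mod_7[OF this] obtain x' q where xq: "x = 7 * x'" "2 * y + z = 7 * q" by (auto elim!: dvdE)
    \<comment> \<open>The form \<open>y\<^sup>2 + y z + 2 z\<^sup>2\<close> is the norm form of
      discriminant -7. Divisibility of \<open>2 * y + z\<close> by 7 lets an element of norm 7 be
      divided out, with quotient given by \<open>p\<close> and \<open>- q\<close>.\<close>
    define p where "p = - y + 4 * q"
    have z: "z = 7 * q - 2 * y" and y: "y = 4 * q - p" using xq(2) by (simp_all add: p_def)
    have "7 * M = 49 * x'\<^sup>2 + 14 * (p\<^sup>2 + p * (- q) + 2 * (- q)\<^sup>2)"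
      unfolding eq z xq(1) y by (simp add: algebra_simps power2_eq_square)
    then have "M = 7 * x'\<^sup>2 + 2 * (p\<^sup>2 + p * (- q) + 2 * (- q)\<^sup>2)" by simp
    then show ?thesis by blast
  qed
qed

section \<open>From the genus to the quaternary form\<close>

definition form_C :: "int \<Rightarrow> int \<Rightarrow> int \<Rightarrow> int" where
  "form_C x y z = 7 * x\<^sup>2 + 7 * y\<^sup>2 + z\<^sup>2"

definition form_T :: "int \<Rightarrow> int \<Rightarrow> int \<Rightarrow> int" where
  "form_T x p q = 7 * x\<^sup>2 + 2 * (p\<^sup>2 + p * q + 2 * q\<^sup>2)"

lemma form_C_sign: "form_C x (- y) z = form_C x y z" "form_C x y (- z) = form_C x y z"
  by (simp_all add: form_C_def)

text \<open>A rational isometry from the first form to the second has denominator 3 and is integral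
  on this sublattice of index 3.\<close>

lemma form_C_eq_form_T:
  assumes "3 dvd x + y + z"
  shows "\<exists>x' p q. form_C x y z = form_T x' p q"
proof -
  obtain t where "x + y + z = 3 * t" using assms by blast
  then have z: "z = 3 * t - x - y" by simp
  have "form_C x y z = form_T t (t - 2 * x - y) (x - y)"
    unfolding z form_C_def form_T_def by (simp add: algebra_simps power2_eq_square)
  then show ?thesis by blast
qed

text \<open>Modulo 3 the form is \<open>x\<^sup>2 + y\<^sup>2 + z\<^sup>2\<close>, so its value
  counts the coordinates prime to 3. If this count is 0, 2 or 3, suitable signs make the sum
  divisible by 3.\<close>

lemma form_C_mod_3:
  assumes "form_C x y z mod 3 \<noteq> 1"
  shows "3 dvd x + y + z \<or> 3 dvd x + y - z \<or> 3 dvd x - y + z \<or> 3 dvd x - y - z"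
proof -
  have r: "x mod 3 \<in> {0, 1, 2}" "y mod 3 \<in> {0, 1, 2}" "z mod 3 \<in> {0, 1, 2}" by (simp_all, presburger+)
  have "form_C x y z mod 3 = ((x mod 3)\<^sup>2 + (y mod 3)\<^sup>2 + (z mod 3)\<^sup>2) mod 3"
  proof -
    have "form_C x y z = x\<^sup>2 + y\<^sup>2 + z\<^sup>2 + 3 * (2 * x\<^sup>2 + 2 * y\<^sup>2)" by (simp add: form_C_def)
    then have "form_C x y z mod 3 = (x\<^sup>2 + y\<^sup>2 + z\<^sup>2) mod 3" by (simp only: mod_mult_self2)
    also have "\<dots> = ((x mod 3)\<^sup>2 + (y mod 3)\<^sup>2 + (z mod 3)\<^sup>2) mod 3"
      by (intro mod_add_cong) (simp_all add: power_mod)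
    finally show ?thesis .
  qed
  then have ne: "((x mod 3)\<^sup>2 + (y mod 3)\<^sup>2 + (z mod 3)\<^sup>2) mod 3 \<noteq> 1" using assms by (simp only: not_False_eq_True)
  have cx: "[x = x mod 3] (mod 3)" and cy: "[y = y mod 3] (mod 3)" and cz: "[z = z mod 3] (mod 3)"
    by (simp_all add: cong_def)
  have sums: "(x + y + z) mod 3 = (x mod 3 + y mod 3 + z mod 3) mod 3"
    "(x + y - z) mod 3 = (x mod 3 + y mod 3 - z mod 3) mod 3"
    "(x - y + z) mod 3 = (x mod 3 - y mod 3 + z mod 3) mod 3"
    "(x - y - z) mod 3 = (x mod 3 - y mod 3 - z mod 3) mod 3"
    unfolding cong_def[symmetric] by (intro cong_add cong_diff cx cy cz)+
  show ?thesis
    unfolding dvd_eq_mod_eq_0 sums using r ne by (elim insertE emptyE) simp_all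
qed

lemma form_T_representation:
  assumes "M > 0" "M mod 7 \<in> {1, 2, 4}" "M mod 3 \<noteq> 1"
  shows "\<exists>x p q. M = form_T x p q"
proof -
  have "\<exists>x p q. M = form_T x p q" if "M = form_C x y z" for x y z
  proof -
    have eqs: "M = form_C x y z" "M = form_C x y (- z)" "M = form_C x (- y) z" "M = form_C x (- y) (- z)"
      using that by (simp_all add: form_C_sign)
    have "3 dvd x + y + z \<or> 3 dvd x + y + (- z) \<or> 3 dvd x + (- y) + z \<or> 3 dvd x + (- y) + (- z)"
      using form_C_mod_3[of x y z] assms(3) that by simp
    then show ?thesis using eqs form_C_eq_form_T by metis
  qed
  then show ?thesis using genus_representation[OF assms(1,2)] unfolding form_C_def form_T_def by blast
qed

text \<open>The quaternary vector built below from a representation \<^term>\<open>M = form_T x p q\<close>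
  with last coordinate \<^term>\<open>w\<close> divisible by 3 can fail to be primitive only at the prime 3,
  and only if 3 divides \<^term>\<open>x\<close>, \<^term>\<open>p\<close> and \<^term>\<open>q\<close>. Such bad
  representations are avoided with the isometries of denominator 3 between the two classes.\<close>

definition lifts_3 :: "int \<Rightarrow> bool" where
  "lifts_3 M \<longleftrightarrow> (\<exists>x p q. 9 * M = form_T x p q \<and> \<not> (3 dvd x \<and> 3 dvd p \<and> 3 dvd q))"

text \<open>Three times the isometry of \<open>form_C_eq_form_T\<close> has first coordinate
  \<open>x + y + z\<close>. If this and its sign variants were all divisible by 3, so would be
  \<open>x\<close>, \<open>y\<close> and \<open>z\<close>.\<close>

lemma lifts_3_form_C:
  assumes "M = form_C x y z" "\<not> (3 dvd x \<and> 3 dvd y \<and> 3 dvd z)"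
  shows "lifts_3 M"
proof -
  have *: "lifts_3 M" if "M = form_C x y z" "\<not> 3 dvd x + y + z" for x y z
  proof -
    have "9 * M = form_T (x + y + z) (z - 5 * x - 2 * y) (3 * (x - y))"
      unfolding that(1) form_C_def form_T_def by (simp add: algebra_simps power2_eq_square)
    then show ?thesis using that(2) unfolding lifts_3_def by blast
  qed
  have "\<not> (3 dvd x + y + z \<and> 3 dvd x + y + (- z) \<and> 3 dvd x + (- y) + z \<and> 3 dvd x + (- y) + (- z))"
    using assms(2) by presburger
  moreover have "M = form_C x y (- z)" "M = form_C x (- y) z" "M = form_C x (- y) (- z)"
    using assms(1) by (simp_all add: form_C_sign)
  ultimately show ?thesis using * assms(1) by blast
qed

text \<open>The two identities are three times the reflections in \<open>(1, -1, 2)\<close> and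
  \<open>(1, 1, -2)\<close>, vectors on which \<open>form_T\<close> takes the value 21. Their first
  coordinates are divisible by 3 only if \<open>x + q\<close>, respectively \<open>x - q\<close>,
  is.\<close>

lemma lifts_3_form_T:
  assumes "M = form_T x p q" "\<not> (3 dvd x \<and> 3 dvd q)"
  shows "lifts_3 M"
proof -
  have "9 * M = form_T (3 * x - 2 * (x + q)) (3 * p + 2 * (x + q)) (3 * q - 4 * (x + q))"
    "9 * M = form_T (3 * x - 2 * (x - q)) (3 * p - 2 * (x - q)) (3 * q + 4 * (x - q))"
    unfolding assms(1) form_T_def by (simp_all add: algebra_simps power2_eq_square)
  moreover have "\<not> 3 dvd 3 * x - 2 * (x + q) \<or> \<not> 3 dvd 3 * x - 2 * (x - q)"
    using assms(2) by presburger
  ultimately show ?thesis unfolding lifts_3_def by blast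
qed

lemma form_T_dvd_3:
  assumes "3 dvd x" "3 dvd q" "form_T x p q mod 3 \<noteq> 2"
  shows "3 dvd p"
proof -
  obtain x' q' where xq: "x = 3 * x'" "q = 3 * q'" using assms by (auto elim!: dvdE)
  have "form_T x p q = 2 * p\<^sup>2 + 3 * (21 * x'\<^sup>2 + 2 * p * q' + 12 * q'\<^sup>2)"
    unfolding xq form_T_def by (simp add: algebra_simps power2_eq_square)
  then have "form_T x p q mod 3 = 2 * p\<^sup>2 mod 3" by (simp only: mod_mult_self2)
  also have "\<dots> = 2 * (p mod 3)\<^sup>2 mod 3" by (intro mod_mult_cong) (simp_all add: power_mod)
  finally have "2 * (p mod 3)\<^sup>2 mod 3 \<noteq> 2" using assms(3) by simp
  moreover have "p mod 3 \<in> {0, 1, 2}" by (simp, presburger)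
  ultimately show ?thesis by (elim insertE emptyE) (simp_all add: dvd_eq_mod_eq_0)
qed

lemma lifts_3_iterate:
  assumes "lifts_3 M"
  shows "lifts_3 (9 * M)"
proof -
  obtain x p q where *: "9 * M = form_T x p q" "\<not> (3 dvd x \<and> 3 dvd p \<and> 3 dvd q)"
    using assms unfolding lifts_3_def by blast
  have "form_T x p q mod 3 = 0" unfolding *(1)[symmetric] by presburger
  then have "\<not> (3 dvd x \<and> 3 dvd q)" using *(2) form_T_dvd_3[of x q p] by auto
  then show ?thesis using lifts_3_form_T[OF *(1)] by blast
qed

text \<open>Descent by the factor 9: a representation divisible by 3 comes from one of
  \<open>M / 9\<close>, and \<open>lifts_3_iterate\<close> returns to \<open>M\<close>. The
  induction hypothesis excludes quotients congruent to 2 modulo 3, which are treated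
  directly.\<close>

lemma lifts_3_genus:
  assumes "M > 0" "M mod 3 \<noteq> 2" "(\<exists>x y z. M = form_C x y z) \<or> (\<exists>x p q. M = form_T x p q)"
  shows "lifts_3 M"
  using assms
proof (induction "nat M" arbitrary: M rule: less_induct)
  case less
  have IH: "lifts_3 M1" if "M = 9 * M1" "M1 mod 3 \<noteq> 2" "(\<exists>x y z. M1 = form_C x y z) \<or> (\<exists>x p q. M1 = form_T x p q)" for M1
    using less.hyps[of M1] less.prems(1) that by auto
  from less.prems(3) show ?case
  proof (elim disjE exE)
    fix x y z assume M: "M = form_C x y z"
    show ?thesis
    proof (cases "3 dvd x \<and> 3 dvd y \<and> 3 dvd z")
      case False then show ?thesis using lifts_3_form_C[OF M] by blast
    next
      case True
      then obtain x1 y1 z1 where 1: "x = 3 * x1" "y = 3 * y1" "z = 3 * z1" by (auto elim!: dvdE)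
      define M1 where "M1 = form_C x1 y1 z1"
      have M1: "M = 9 * M1" unfolding M M1_def 1 form_C_def by (simp add: algebra_simps)
      have "lifts_3 M1"
      proof (cases "M1 mod 3 = 2")
        case True
        have "\<not> (3 dvd x1 \<and> 3 dvd y1 \<and> 3 dvd z1)"
        proof
          assume "3 dvd x1 \<and> 3 dvd y1 \<and> 3 dvd z1"
          then have "3 dvd M1" unfolding M1_def form_C_def by (auto simp: power2_eq_square)
          then show False using True by presburger
        qed
        then show ?thesis using lifts_3_form_C[OF M1_def] by blast
      qed (use IH[OF M1] M1_def in blast)
      then show ?thesis unfolding M1 by (rule lifts_3_iterate)
    qed
  next
    fix x p q assume M: "M = form_T x p q"
    show ?thesis
    proof (cases "3 dvd x \<and> 3 dvd q")
      case False then show ?thesis using lifts_3_form_T[OF M] by blast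
    next
      case True
      then have "3 dvd p" using form_T_dvd_3 less.prems(2) M by blast
      with True obtain x1 p1 q1 where 1: "x = 3 * x1" "p = 3 * p1" "q = 3 * q1" by (auto elim!: dvdE)
      define M1 where "M1 = form_T x1 p1 q1"
      have M1: "M = 9 * M1" unfolding M M1_def 1 form_T_def by (simp add: algebra_simps power2_eq_square)
      show ?thesis
      proof (cases "M1 mod 3 = 2 \<and> 3 dvd x1 \<and> 3 dvd q1")
        case False
        then have "lifts_3 M1" using IH[OF M1] lifts_3_form_T[OF M1_def] M1_def by blast
        then show ?thesis unfolding M1 by (rule lifts_3_iterate)
      next
        case True
        have "\<not> 3 dvd p1"
        proof
          assume "3 dvd p1"
          then have "3 dvd M1" using True unfolding M1_def form_T_def by (auto simp: power2_eq_square)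
          then show False using True by presburger
        qed
        then have "\<not> 3 dvd x1 - p1 + q1" using True by presburger
        \<comment> \<open>Three times the inverse of the isometry in
          \<open>form_C_eq_form_T\<close>; its first coordinate is prime to 3.\<close>
        moreover have "M = form_C (x1 - p1 + q1) (x1 - p1 - 2 * q1) (7 * x1 + 2 * p1 + q1)"
          unfolding M1 M1_def form_C_def form_T_def by (simp add: algebra_simps power2_eq_square)
        ultimately show ?thesis using lifts_3_form_C by blast
      qed
    qed
  qed
qed

section \<open>Lifting to the quaternary form\<close>

text \<open>The substitution \<open>p = w + y + 4 z\<close>, \<open>q = - 2 y - z\<close> turns
  \<open>7 * Q47_1\<close> into the right side. It can be inverted over the integers if 7 divides
  \<open>w - (p + 4 * q)\<close>, which the equation guarantees after possibly negating
  \<open>p\<close> and \<open>q\<close>.\<close>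

lemma Q47_1_from_form_T:
  assumes eq: "7 * n = form_T x p q + 47 * w\<^sup>2" and w: "\<not> 7 dvd w"
  shows "\<exists>y z. Q47_1 x y z w = n \<and> (3 dvd y \<and> 3 dvd z \<and> 3 dvd w \<longrightarrow> 3 dvd p \<and> 3 dvd q)"
proof -
  have *: "\<exists>y z. Q47_1 x y z w = n \<and> (3 dvd y \<and> 3 dvd z \<and> 3 dvd w \<longrightarrow> 3 dvd p \<and> 3 dvd q)"
    if eq: "7 * n = form_T x p q + 47 * w\<^sup>2" and "7 dvd w - (p + 4 * q)" for p q
  proof -
    obtain y where y: "w - (p + 4 * q) = 7 * y" using \<open>7 dvd w - (p + 4 * q)\<close> by blast
    define z where "z = - 2 * y - q"
    have p: "p = w + y + 4 * z" and q: "q = - 2 * y - z" using y by (simp_all add: z_def)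
    have "7 * Q47_1 x y z w = 7 * n"
      unfolding eq p q Q47_1_def form_T_def by (simp add: algebra_simps power2_eq_square)
    then have "Q47_1 x y z w = n" by simp
    moreover have "3 dvd y \<and> 3 dvd z \<and> 3 dvd w \<longrightarrow> 3 dvd p \<and> 3 dvd q" unfolding p q by auto
    ultimately show ?thesis by blast
  qed
  \<comment> \<open>Modulo 7 the binary part of \<open>form_T\<close> is
    \<open>2 * (p + 4 * q)\<^sup>2\<close> and 47 is -2, so the equation becomes a difference of two
    squares.\<close>
  have "2 * ((w - (p + 4 * q)) * (w + (p + 4 * q))) = 7 * (7 * w\<^sup>2 + x\<^sup>2 - n - 2 * p * q - 4 * q\<^sup>2)"
    using eq unfolding form_T_def by (simp add: algebra_simps power2_eq_square)
  then have "7 dvd 2 * ((w - (p + 4 * q)) * (w + (p + 4 * q)))" by (metis dvd_triv_left)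
  then have "7 dvd w - (p + 4 * q) \<or> 7 dvd w + (p + 4 * q)"
    using prime_dvd_mult_iff[of "7 :: int"] by auto
  then show ?thesis
  proof
    assume "7 dvd w - (p + 4 * q)" then show ?thesis using * eq by blast
  next
    assume "7 dvd w + (p + 4 * q)"
    moreover have "w - ((- p) + 4 * (- q)) = w + (p + 4 * q)" by simp
    ultimately have "7 dvd w - ((- p) + 4 * (- q))" by (simp only:)
    moreover have "7 * n = form_T x (- p) (- q) + 47 * w\<^sup>2" using eq unfolding form_T_def by simp
    ultimately show ?thesis using *[of "- p" "- q"] by simp
  qed
qed

lemma Gcd_eq_1_of_dvd_9:
  fixes x y z w :: int
  assumes "w dvd 9" "\<not> (3 dvd x \<and> 3 dvd y \<and> 3 dvd z \<and> 3 dvd w)"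
  shows "Gcd {x, y, z, w} = 1"
proof -
  define g where "g = Gcd {x, y, z, w}"
  have dvd: "g dvd x" "g dvd y" "g dvd z" "g dvd w" unfolding g_def by (rule Gcd_dvd; simp)+
  then have "\<not> 3 dvd g" using assms(2) dvd_trans by blast
  then have "coprime 3 g" by (intro prime_imp_coprime) simp_all
  then have "coprime g (3 ^ 2)" by (simp only: coprime_commute[of g] coprime_power_left_iff) simp
  moreover have "g dvd 3 ^ 2" using dvd(4) assms(1) dvd_trans by simp
  ultimately have "is_unit g" by (rule coprime_common_divisor[OF _ dvd_refl])
  moreover have "g \<ge> 0" unfolding g_def by simp
  ultimately show ?thesis unfolding g_def by simp
qed

section \<open>Small values by explicit vectors with a coordinate 1\<close>

lemma primitive_of_witnesses:
  assumes "map (\<lambda>(x, y, z, w). Q47_1 x y z w) L = ns" and "list_all (\<lambda>(x, y, z, w). x = 1 \<or> y = 1) L"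
    and "n \<in> set ns"
  shows "\<exists>x y z w. Q47_1 x y z w = n \<and> Gcd {x, y, z, w} = 1"
proof -
  obtain x y z w where "(x, y, z, w) \<in> set L" "Q47_1 x y z w = n"
    using assms(1,3) by fastforce
  moreover from this(1) have "x = 1 \<or> y = 1" using assms(2) by (auto simp: list_all_iff)
  ultimately show ?thesis by (intro exI[of _ x] exI[of _ y] exI[of _ z] exI[of _ w]) auto
qed

lemma primitive_multiple_of_3_le_60:
  assumes "1 \<le> m" "m \<le> 20"
  shows "\<exists>x y z w. Q47_1 x y z w = 3 * m \<and> Gcd {x, y, z, w} = 1"
proof (rule primitive_of_witnesses)
  show "map (\<lambda>(x, y, z, w). Q47_1 x y z w)
     [(1, 1, 0, 0), (2, 1, 0, 0), (1, 1, 1, 0), (2, 1, 1, 0), (1, - 1, 2, 0), (1, 1, 1, 1), (2,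
      1, 1, 1), (4, 1, 1, 0), (5, 1, 0, 0), (0, 1, 0, 2), (1, 2, 2, 0), (1, 4, - 2, 1), (3, 1,
      0, 2), (3, 1, 2, 1), (1, 1, 3, 0), (2, 1, 3, 0), (1, 5, 0, 0), (1, 4, 1, 1), (1, 2, 3, 0),
      (4, 1, 3, 0)] = map (\<lambda>m. 3 * m) [1..20]"
    by (simp add: Q47_1_def upto.simps)
  show "3 * m \<in> set (map (\<lambda>m. 3 * m) [1..20])" using assms by (simp only: set_map set_upto) simp
qed simp

text \<open>These are the values for which the last coordinate 9 would be required but is too large:
  \<open>7 * (3 * m + 1)\<close> exceeds \<open>47 * 9\<close> only from \<open>m = 20\<close>
  on.\<close>

lemma primitive_9_mod_27_le_522:
  assumes "0 \<le> m" "m \<le> 19"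
  shows "\<exists>x y z w. Q47_1 x y z w = 27 * m + 9 \<and> Gcd {x, y, z, w} = 1"
proof (rule primitive_of_witnesses)
  show "map (\<lambda>(x, y, z, w). Q47_1 x y z w)
     [(1, 1, 1, 0), (1, 4, - 2, 1), (7, 1, - 2, 0), (1, 1, 4, 1), (1, 5, 3, 0), (1, 4, 4, 1),
      (13, 1, 0, 0), (1, 5, 3, 3), (1, 4, 6, 0), (1, 8, 2, 3), (1, 5, - 4, 6), (1, 4, 7, 1), (1,
      1, 3, 6), (1, 10, 4, 1), (1, 5, 8, 0), (1, 7, 7, 1), (1, 2, 5, 6), (1, 8, 6, 3), (1, 11,
      0, 6), (1, 13, 4, 1)] = map (\<lambda>m. 27 * m + 9) [0..19]"
    by (simp add: Q47_1_def upto.simps)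
  show "27 * m + 9 \<in> set (map (\<lambda>m. 27 * m + 9) [0..19])"
    using assms by (simp only: set_map set_upto) simp
qed simp

section \<open>Primitive representations according to divisibility by 3 and 9\<close>

text \<open>With \<open>w = 1\<close> the number \<open>7 * n - 47\<close> is 2 modulo 7 and
  \<open>n + 1\<close> modulo 3, so it avoids the excluded class 1 exactly when 3 does not divide
  \<open>n\<close>.\<close>

lemma primitive_not_dvd_3:
  assumes "n > 0" "\<not> 3 dvd n"
  shows "\<exists>x y z w. Q47_1 x y z w = n \<and> Gcd {x, y, z, w} = 1"
proof (cases "n \<ge> 7")
  case True
  define M where "M = 7 * n - 47"
  have "M > 0" using True unfolding M_def by simp
  moreover have "M = 2 + 7 * (n - 7)" unfolding M_def by simp
  then have "M mod 7 = 2" by (simp only: mod_mult_self2) simp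
  moreover have "M = (n + 1) + 3 * (2 * n - 16)" unfolding M_def by simp
  then have "M mod 3 = (n + 1) mod 3" by (simp only: mod_mult_self2)
  then have "M mod 3 \<noteq> 1" using assms(2) by presburger
  ultimately obtain x p q where "M = form_T x p q" using form_T_representation[of M] by auto
  then have "7 * n = form_T x p q + 47 * 1\<^sup>2" unfolding M_def by simp
  then obtain y z where "Q47_1 x y z 1 = n" using Q47_1_from_form_T[of n x p q 1] by auto
  moreover have "Gcd {x, y, z, 1} = 1" by simp
  ultimately show ?thesis by blast
next
  case False
  then have "n = 1 \<or> n = 2 \<or> n = 4 \<or> n = 5" using assms by presburger
  then have set: "n \<in> set [1, 2, 4, 5]" by auto
  have "map (\<lambda>(x, y, z, w). Q47_1 x y z w) [(1, 0, 0, 0), (0, 1, 0, 0), (0, 1, - 1, 0), (1, 0, 1, 0)] = [1, 2, 4, 5]"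
    by (simp add: Q47_1_def)
  then show ?thesis by (rule primitive_of_witnesses[OF _ _ set]) simp
qed

text \<open>With \<open>w = 3\<close> only the prime 3 can divide all coordinates, and then 9 would
  divide \<open>n\<close>. The bound on \<open>m\<close> makes \<open>7 * n - 47 * 9\<close>
  positive.\<close>

lemma primitive_3_not_9:
  assumes "n > 0" "3 dvd n" "\<not> 9 dvd n"
  shows "\<exists>x y z w. Q47_1 x y z w = n \<and> Gcd {x, y, z, w} = 1"
proof -
  obtain m where m: "n = 3 * m" using assms(2) by blast
  show ?thesis
  proof (cases "m \<ge> 21")
    case True
    define M where "M = 7 * n - 423"
    have "M > 0" using True unfolding M_def m by simp
    moreover have "M = 4 + 7 * (n - 61)" unfolding M_def by simp
    then have "M mod 7 = 4" by (simp only: mod_mult_self2) simp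
    moreover have "M = 0 + 3 * (7 * m - 141)" unfolding M_def m by simp
    then have "M mod 3 = 0" by (simp only: mod_mult_self2) simp
    ultimately obtain x p q where "M = form_T x p q" using form_T_representation[of M] by auto
    then have "7 * n = form_T x p q + 47 * 3\<^sup>2" unfolding M_def by simp
    then obtain y z where Q: "Q47_1 x y z 3 = n" using Q47_1_from_form_T[of n x p q 3] by auto
    have "\<not> (3 dvd x \<and> 3 dvd y \<and> 3 dvd z \<and> 3 dvd (3 :: int))"
    proof
      assume "3 dvd x \<and> 3 dvd y \<and> 3 dvd z \<and> 3 dvd (3 :: int)"
      then obtain x' y' z' where "x = 3 * x'" "y = 3 * y'" "z = 3 * z'" by (auto elim!: dvdE)
      then have "n = 9 * Q47_1 x' y' z' 1"
        using Q unfolding Q47_1_def by (simp add: algebra_simps power2_eq_square)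
      then show False using assms(3) by simp
    qed
    then have "Gcd {x, y, z, 3} = 1" by (intro Gcd_eq_1_of_dvd_9) simp_all
    then show ?thesis using Q by blast
  next
    case False
    then show ?thesis using primitive_multiple_of_3_le_60[of m] assms(1) m by simp
  qed
qed

text \<open>Here the last coordinate is \<open>3 * w\<close>, since
  \<open>9 * M = 7 * (9 * n) - 47 * (3 * w)\<^sup>2\<close>. The property \<open>lifts_3\<close>
  supplies a representation of \<open>9 * M\<close> not divisible by 3, which prevents a common
  factor 3.\<close>

lemma primitive_9_aux:
  assumes w: "w = 1 \<or> w = 3" and pos: "7 * n - 47 * w\<^sup>2 > 0" and mod3: "(n + w\<^sup>2) mod 3 \<noteq> 2"
  shows "\<exists>x y z w. Q47_1 x y z w = 9 * n \<and> Gcd {x, y, z, w} = 1"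
proof -
  define M where "M = 7 * n - 47 * w\<^sup>2"
  have "M = 2 + 7 * (n - 7) \<or> M = 4 + 7 * (n - 61)" using w unfolding M_def by auto
  then have "M mod 7 = 2 \<or> M mod 7 = 4" by (elim disjE; simp only: mod_mult_self2; simp)
  moreover have "M = (n + w\<^sup>2) + 3 * (2 * n - 16 * w\<^sup>2)" unfolding M_def by simp
  then have "M mod 3 = (n + w\<^sup>2) mod 3" by (simp only: mod_mult_self2)
  then have "M mod 3 \<noteq> 2" using mod3 by simp
  moreover have "M > 0" using pos by (simp add: M_def)
  ultimately have "lifts_3 M"
    using genus_representation[of M] by (intro lifts_3_genus) (auto simp: form_C_def form_T_def)
  then obtain x p q where T: "9 * M = form_T x p q" "\<not> (3 dvd x \<and> 3 dvd p \<and> 3 dvd q)"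
    unfolding lifts_3_def by blast
  have "7 * (9 * n) = form_T x p q + 47 * (3 * w)\<^sup>2"
    unfolding T(1)[symmetric] M_def by (simp add: power_mult_distrib)
  moreover have "\<not> 7 dvd 3 * w" using w by auto
  ultimately obtain y z where Q: "Q47_1 x y z (3 * w) = 9 * n"
    "3 dvd y \<and> 3 dvd z \<and> 3 dvd 3 * w \<longrightarrow> 3 dvd p \<and> 3 dvd q"
    using Q47_1_from_form_T[of "9 * n" x p q "3 * w"] by blast
  have "Gcd {x, y, z, 3 * w} = 1"
    using w Q(2) T(2) by (intro Gcd_eq_1_of_dvd_9) auto
  then show ?thesis using Q(1) by blast
qed

lemma primitive_9:
  assumes "n > 0"
  shows "\<exists>x y z w. Q47_1 x y z w = 9 * n \<and> Gcd {x, y, z, w} = 1"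
proof (cases "n mod 3 = 1")
  case True
  define m where "m = n div 3"
  have m: "n = 3 * m + 1" using True div_mult_mod_eq[of n 3] unfolding m_def by simp
  show ?thesis
  proof (cases "m \<ge> 20")
    case ge: True
    \<comment> \<open>For \<open>n\<close> congruent to 1 modulo 3 the choice \<open>w = 1\<close>
      would give the excluded residue 2, whereas \<open>w = 3\<close> leaves the residue 1.\<close>
    have "n + 3\<^sup>2 = n + 3 * 3" by simp
    then have "(n + 3\<^sup>2) mod 3 = 1" using True by (simp only: mod_mult_self2)
    then have "(n + 3\<^sup>2) mod 3 \<noteq> 2" by (simp only:)
    moreover have "7 * n - 47 * 3\<^sup>2 > 0" using ge m by simp
    ultimately show ?thesis by (intro primitive_9_aux[of 3]) simp_all
  next
    case False
    then show ?thesis using primitive_9_mod_27_le_522[of m] assms m by simp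
  qed
next
  case False
  show ?thesis
  proof (cases "n \<ge> 7")
    case True
    have "(n + 1\<^sup>2) mod 3 \<noteq> 2" using False by (simp only: one_power2) presburger
    moreover have "7 * n - 47 * 1\<^sup>2 > 0" using True by simp
    ultimately show ?thesis by (intro primitive_9_aux[of 1]) simp_all
  next
    case lt: False
    then show ?thesis using primitive_multiple_of_3_le_60[of "3 * n"] assms by simp
  qed
qed

theorem theorem4p5:
  shows "primitively_universal Q47_1"
  unfolding primitively_universal_def
proof (intro allI impI)
  fix n :: int assume n: "n > 0"
  show "\<exists>x y z w. Q47_1 x y z w = n \<and> Gcd {x, y, z, w} = 1"
  proof (cases "9 dvd n")
    case True
    then obtain m where "n = 9 * m" by blast
    then show ?thesis using primitive_9[of m] n by auto
  next
    case False
    then show ?thesis using primitive_not_dvd_3[OF n] primitive_3_not_9[OF n] by blast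
  qed
qed

end
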